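(* Let $(G,w)$ be a weighted graph, and let $\{C_j\}_{j\in J}$ be the set of its simple oriented circuits, viewed as vectors of $\mathcal C(G,\mathbb R)$. Then the unit ball in $H_1(G,\mathbb R)\subset \mathcal C(G,\mathbb R)$ of the stable norm $\|\cdot\|_w$ for the metric $w$ coincides with the convex hull in $\mathcal C(G,\mathbb R)$ of the vectors $\{C_j/\|C_j\|_w\}_{j\in J}$.
   Context: A weighted graph $(G,w)$ is a pair where $G=(V,E)$ is a finite connected non-oriented multigraph (multiple edges and loops allowed) and $w:E\to\mathbb R_+$ is a weight function on the edges. It carries the metric induced by viewing each edge $e$ as an interval of length $w(e)$. Choose an arbitrary orientation of each edge, giving oriented edges $e_1,\dots,e_k$. $\mathcal C(G,\mathbb R)=\{\sum_{i=1}^k a_i e_i : a_i\in\mathbb R\}$ is the vector space generated by the oriented edges, that is, the space of 1-chains of $G$. As $G$ has no cells of dimension $\ge 2$, $H_1(G,\mathbb R)$ is naturally embedded in $\mathcal C(G,\mathbb R)$ as the subspace of cycles, and $H_1(G,\mathbb Z)$ is a lattice in it. A simple oriented circuit is an oriented closed path made of distinct edges and visiting each of its vertices exactly once (a loop is a circuit of length one), two such being identified if they coincide geometrically with the same orientation and differ only by the starting point. Each geometric simple circuit yields two simple oriented circuits. A simple oriented circuit is identified with the vector of $\mathcal C(G,\mathbb R)$ which is the sum of its edges, each with sign $+1$ or $-1$ according to whether it is traversed along its chosen orientation or against it. This vector lies in $H_1(G,\mathbb R)$. Stable norm: for an integer class $v$ (in the lattice $H_1(G,\mathbb Z)$), $\|v\|_w=\lim_{n\to+\infty}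 L_w(\gamma_n)/n$, where $\gamma_n$ is a shortest closed curve realizing the class $nv$ and $L_w$ is length. This defines by continuity a norm on $H_1(G,\mathbb R)$, the stable norm, whose unit ball is $\{u\in H_1(G,\mathbb R): \|u\|_w\le 1\}$.
   Formalization: The formal theorem assumes that H_1(G,R) is nonzero; for a tree there are no simple circuits, so the convex hull is empty while the unit ball is {0}, and the statement as written fails. *)

theory Defs
  imports "HOL-Complex_Analysis.Complex_Analysis"
begin

text \<open>
  Vertices and edges are the elements of the finite types \<open>'v\<close> and \<open>'e\<close>; the chosen orientation
  of an edge \<open>e\<close> runs from \<open>src e\<close> to \<open>tgt e\<close>. Loops and multiple edges are allowed.
  The space of 1-chains is \<open>real ^ 'e\<close>, the oriented edge \<open>e\<close> being the basis vector \<open>axis e 1\<close>.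
\<close>

locale weighted_graph =
  fixes src tgt :: "'e::finite \<Rightarrow> 'v::finite" and w :: "'e \<Rightarrow> real"
  assumes weight_pos: "\<And>e. w e > 0"
    and connected: "\<And>x y. (x, y) \<in> {(a, b). \<exists>e. (a = src e \<and> b = tgt e) \<or> (a = tgt e \<and> b = src e)}\<^sup>*"

text \<open>Points of the geometric realization: vertices, and points in the interior of an edge given
  by their distance to the source, measured along the edge.\<close>

datatype ('v, 'e) graph_point = Vertex 'v | Interior 'e real

context weighted_graph
begin

definition boundary :: "real ^ 'e \<Rightarrow> real ^ 'v" where
  "boundary c = (\<Sum>e\<in>UNIV. (c $ e) *\<^sub>R (axis (tgt e) 1 - axis (src e) 1))"

definition H1 :: "(real ^ 'e) set" where
  "H1 = {c. boundary c = 0}"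

definition H1_int :: "(real ^ 'e) set" where
  "H1_int = {c \<in> H1. \<forall>e. c $ e \<in> \<int>}"

definition points :: "('v, 'e) graph_point set" where
  "points = range Vertex \<union> {Interior e t | e t. 0 < t \<and> t < w e}"

text \<open>The characteristic map of the closed edge \<open>e\<close>, defined for \<open>s\<close> in \<open>{0..w e}\<close>.\<close>

definition edge_point :: "'e \<Rightarrow> real \<Rightarrow> ('v, 'e) graph_point" where
  "edge_point e s = (if s = 0 then Vertex (src e) else if s = w e then Vertex (tgt e) else Interior e s)"

text \<open>\<open>edge_chain x y r\<close>: one can go from \<open>x\<close> to \<open>y\<close> by finitely many segments, each contained
  in one closed edge, of total length \<open>r\<close>. The infimum of such \<open>r\<close> is the quotient metric obtained
  by gluing the intervals \<open>{0..w e}\<close> at their endpoints.\<close>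

inductive edge_chain :: "('v, 'e) graph_point \<Rightarrow> ('v, 'e) graph_point \<Rightarrow> real \<Rightarrow> bool" where
  refl: "edge_chain x x 0"
| step: "\<lbrakk>s \<in> {0..w e}; t \<in> {0..w e}; edge_chain (edge_point e t) y r\<rbrakk>
         \<Longrightarrow> edge_chain (edge_point e s) y (\<bar>s - t\<bar> + r)"

text \<open>The value off \<open>points\<close> is irrelevant, but \<open>Metric_space\<close> requires it to be
  symmetric and nonnegative.\<close>

definition gdist :: "('v, 'e) graph_point \<Rightarrow> ('v, 'e) graph_point \<Rightarrow> real" where
  "gdist x y = (if x \<in> points \<and> y \<in> points then Inf {r. edge_chain x y r} else 0)"

definition closed_curve :: "(real \<Rightarrow> ('v, 'e) graph_point) \<Rightarrow> bool" where
  "closed_curve \<gamma> \<longleftrightarrow> pathin (Metric_space.mtopology points gdist) \<gamma> \<and> \<gamma> 0 = \<gamma> 1"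

definition curve_length :: "(real \<Rightarrow> ('v, 'e) graph_point) \<Rightarrow> ennreal" where
  "curve_length \<gamma> =
     (SUP (n, t) \<in> {(n :: nat, t :: nat \<Rightarrow> real). mono t \<and> range t \<subseteq> {0..1}}.
        \<Sum>i<n. ennreal (gdist (\<gamma> (t i)) (\<gamma> (t (Suc i)))))"

text \<open>Collapsing the complement of the open edge \<open>e\<close> to a point maps the graph onto a circle.
  The \<open>e\<close>-coordinate of the cellular homology class of a closed curve is the degree of its
  composition with this map (the projection of \<open>H\<^sub>1\<close> of the graph to \<open>H\<^sub>1\<close> of the circle).\<close>

definition collapse :: "'e \<Rightarrow> ('v, 'e) graph_point \<Rightarrow> complex" where
  "collapse e p = (case p of Vertex _ \<Rightarrow> 1
                   | Interior e' t \<Rightarrow> if e' = e then cis (2 * pi * t / w e) else 1)"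

definition homology_class :: "(real \<Rightarrow> ('v, 'e) graph_point) \<Rightarrow> real ^ 'e" where
  "homology_class \<gamma> = (\<chi> e. Re (winding_number (collapse e \<circ> \<gamma>) 0))"

definition shortest_length :: "real ^ 'e \<Rightarrow> real" where
  "shortest_length v =
     enn2real (INF \<gamma> \<in> {\<gamma>. closed_curve \<gamma> \<and> homology_class \<gamma> = v}. curve_length \<gamma>)"

definition stable_norm_int :: "real ^ 'e \<Rightarrow> real" where
  "stable_norm_int v = lim (\<lambda>n. shortest_length (real n *\<^sub>R v) / real n)"

text \<open>Extension to rational classes by homogeneity and then to real classes by continuity.
  The value \<open>0\<close> off \<open>H1\<close> only serves to make the function unique.\<close>

definition stable_norm :: "real ^ 'e \<Rightarrow> real" where
  "stable_norm =
     (THE N. continuous_on H1 N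
           \<and> (\<forall>v\<in>H1_int. \<forall>k::nat. k > 0 \<longrightarrow> N (v /\<^sub>R real k) = stable_norm_int v / real k)
           \<and> (\<forall>u. u \<notin> H1 \<longrightarrow> N u = 0))"

text \<open>An oriented edge is a pair \<open>(e, b)\<close>, traversed along its chosen orientation iff \<open>b\<close>.\<close>

definition tail :: "'e \<times> bool \<Rightarrow> 'v" where
  "tail a = (if snd a then src (fst a) else tgt (fst a))"

definition head :: "'e \<times> bool \<Rightarrow> 'v" where
  "head a = (if snd a then tgt (fst a) else src (fst a))"

definition simple_circuit :: "('e \<times> bool) list \<Rightarrow> bool" where
  "simple_circuit p \<longleftrightarrow> p \<noteq> [] \<and> distinct (map fst p) \<and> distinct (map tail p)
     \<and> (\<forall>i<length p. head (p ! i) = tail (p ! (Suc i mod length p)))"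

definition circuit_vector :: "('e \<times> bool) list \<Rightarrow> real ^ 'e" where
  "circuit_vector p = (\<Sum>(e, b)\<leftarrow>p. axis e (if b then 1 else -1))"

definition circuits :: "(real ^ 'e) set" where
  "circuits = circuit_vector ` {p. simple_circuit p}"

end

end

theory Submission
  imports Defs
begin

text \<open>
  The theorem rests on the identification of the stable norm of a cycle \<open>u\<close> with the weighted
  \<open>\<ell>\<^sup>1\<close> norm \<open>\<Sum>e. w e * \<bar>u $ e\<bar>\<close>, called \<open>wnorm\<close> below. Once this is known, the unit ball is
  found from a purely combinatorial fact (\<open>circuit_decomposition\<close>): every cycle is a nonnegative
  combination of simple circuits that all run along the edges in the direction given by the signs of
  the cycle, so that no cancellation occurs and \<open>wnorm\<close> is additive on the combination. Dividing by
  norms turns such a combination into a convex combination of normalized circuits; the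
  point \<open>0\<close> is the midpoint of two antipodal normalized cycles.

  A closed curve in the class \<open>v\<close> has length at least \<open>wnorm v\<close> (\<open>wnorm_le_curve_length\<close>): collapsing
  everything but the open edge \<open>e\<close> gives a loop in a circle of circumference \<open>w e\<close>, which turns
  \<open>v $ e\<close> times. The lengths contributed by different edges add up, because already the distance of
  two points dominates the sum over all edges of the distances of their images in these circles
  (\<open>sum_int_dist_coord_le_gdist\<close>).

  Conversely, an integral cycle \<open>v\<close> is a sum of simple circuits with coefficients in the natural
  numbers, the norms adding up. A walk that starts at a base vertex, visits these circuits in turn,
  and runs through each of them \<open>n\<close> times its coefficient represents \<open>n v\<close>. Its length is
  \<open>n * wnorm v\<close> plus the cost of the connecting paths, which does not depend on \<open>n\<close>, so after division
  by \<open>n\<close> the limit is \<open>wnorm v\<close>. Since rational cycles are dense in the space of cycles, \<open>wnorm\<close>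
  is the only continuous extension.
\<close>

section \<open>Distance to the nearest integer\<close>

text \<open>
  On the circle \<open>\<real>/\<int>\<close> this function is the distance to the neutral element.
\<close>

definition int_dist :: "real \<Rightarrow> real" where
  "int_dist x = \<bar>x - of_int (round x)\<bar>"

lemma int_dist_le: "k \<in> \<int> \<Longrightarrow> int_dist x \<le> \<bar>x - k\<bar>"
  unfolding int_dist_def by (elim Ints_cases) (simp add: round_diff_minimal)

lemma int_dist_nonneg [simp]: "0 \<le> int_dist x"
  by (simp add: int_dist_def)

lemma int_dist_zero [simp]: "int_dist 0 = 0"
  by (simp add: int_dist_def)

lemma int_dist_triangle: "int_dist (x + y) \<le> int_dist x + int_dist y"
  using int_dist_le[of "of_int (round x) + of_int (round y)" "x + y"]
  by (simp add: int_dist_def)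

text \<open>
  An increment of a lift to the line that is smaller than half a turn is seen faithfully by the
  distance on the circle; here \<open>x\<close> is the increment of the lift and \<open>y\<close> that of some coordinate which
  is only determined modulo \<open>\<int>\<close>.
\<close>

lemma int_dist_eq_abs:
  assumes "\<bar>x\<bar> < 1/2" "x - y \<in> \<int>"
  shows "int_dist y = \<bar>x\<bar>"
proof -
  from assms(2) obtain k where k: "x - y = of_int k" by (elim Ints_cases)
  then have "round y = - k"
    using assms(1) by (intro round_unique') (simp add: algebra_simps)
  with k show ?thesis by (simp add: int_dist_def algebra_simps)
qed

lemma norm_cis_diff_le: "cmod (cis a - cis b) \<le> \<bar>a - b\<bar>"
proof -
  have "cis a - cis b = cis b * (exp (\<i> * complex_of_real (a - b)) - 1)"
    by (simp add: cis_conv_exp algebra_simps flip: exp_add)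
  then have "cmod (cis a - cis b) = 2 * \<bar>sin ((a - b) / 2)\<bar>"
    by (metis dist_exp_i_1 mult_1 norm_cis norm_mult)
  also have "\<dots> \<le> \<bar>a - b\<bar>"
    using abs_sin_x_le_abs_x[of "(a - b) / 2"] by simp
  finally show ?thesis .
qed

lemma cis_2pi_eq_iff: "cis (2 * pi * a) = cis (2 * pi * b) \<longleftrightarrow> a - b \<in> \<int>"
proof -
  have "cis (2 * pi * a) = cis (2 * pi * b) \<longleftrightarrow> cis (2 * pi * (a - b)) = 1"
    by (simp add: right_diff_distrib flip: cis_divide)
  also have "\<dots> \<longleftrightarrow> (\<exists>n::int. a - b = of_int n)"
  proof
    assume "cis (2 * pi * (a - b)) = 1"
    then have "cos (2 * pi * (a - b)) = 1" by (simp add: complex_eq_iff)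
    then show "\<exists>n::int. a - b = of_int n"
      by (auto simp: cos_one_2pi_int)
  qed (auto simp: cis_multiple_2pi)
  finally show ?thesis by (auto simp: Ints_def)
qed

context weighted_graph
begin

lemma w_nonneg [simp]: "0 \<le> w e" and w_nonzero [simp]: "w e \<noteq> 0"
  using weight_pos[of e] by simp_all

section \<open>The metric\<close>

lemma edge_point_0 [simp]: "edge_point e 0 = Vertex (src e)"
  and edge_point_w [simp]: "edge_point e (w e) = Vertex (tgt e)"
  by (simp_all add: edge_point_def)

lemma edge_point_in_points: "s \<in> {0..w e} \<Longrightarrow> edge_point e s \<in> points"
  by (auto simp: edge_point_def points_def)

lemma Vertex_in_points [simp]: "Vertex v \<in> points"
  by (simp add: points_def)

lemma edge_chain_nonneg: "edge_chain x y r \<Longrightarrow> 0 \<le> r"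
  by (induction rule: edge_chain.induct) auto

lemma edge_chain_trans:
  "edge_chain x y r \<Longrightarrow> edge_chain y z r' \<Longrightarrow> edge_chain x z (r + r')"
proof (induction rule: edge_chain.induct)
  case (step s e t y r)
  then show ?case
    using edge_chain.step[of s e t z "r + r'"] by (simp add: add.assoc)
qed auto

lemma edge_chain_segment:
  "s \<in> {0..w e} \<Longrightarrow> t \<in> {0..w e} \<Longrightarrow> edge_chain (edge_point e s) (edge_point e t) \<bar>s - t\<bar>"
  using edge_chain.step[of s e t "edge_point e t" 0] edge_chain.refl by simp

lemma edge_chain_sym: "edge_chain x y r \<Longrightarrow> edge_chain y x r"
proof (induction rule: edge_chain.induct)
  case (step s e t y r)
  then show ?case
    using edge_chain_trans[OF step.IH edge_chain_segment[of t e s]]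
    by (simp add: abs_minus_commute add.commute)
qed (rule edge_chain.refl)

lemma edge_chain_vertices: "\<exists>r. edge_chain (Vertex a) (Vertex b) r"
proof -
  have "(a, b) \<in> {(a, b). \<exists>e. (a = src e \<and> b = tgt e) \<or> (a = tgt e \<and> b = src e)}\<^sup>*"
    by (rule connected)
  then show ?thesis
  proof (induction rule: rtrancl_induct)
    case base
    show ?case using edge_chain.refl by blast
  next
    case (step y z)
    then obtain e where e: "(y = src e \<and> z = tgt e) \<or> (y = tgt e \<and> z = src e)" by auto
    have "edge_chain (Vertex (src e)) (Vertex (tgt e)) (w e)"
      using edge_chain_segment[of 0 e "w e"] by simp
    then have "edge_chain (Vertex y) (Vertex z) (w e)"
      using e edge_chain_sym by blast
    then show ?case using step.IH edge_chain_trans by blast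
  qed
qed

lemma edge_chain_exists:
  assumes "x \<in> points" "y \<in> points"
  shows "\<exists>r. edge_chain x y r"
proof -
  have *: "\<exists>v r. edge_chain x (Vertex v) r" if "x \<in> points" for x
  proof (cases x)
    case (Vertex v)
    then show ?thesis using edge_chain.refl by blast
  next
    case (Interior e t)
    then have t: "0 < t" "t < w e" using that by (auto simp: points_def)
    then have "edge_chain x (Vertex (src e)) \<bar>t - 0\<bar>"
      using edge_chain_segment[of t e 0] Interior by (simp add: edge_point_def)
    then show ?thesis by blast
  qed
  from *[OF assms(1)] *[OF assms(2)] obtain a r b r'
    where "edge_chain x (Vertex a) r" "edge_chain (Vertex b) y r'"
    using edge_chain_sym by blast
  with edge_chain_vertices[of a b] show ?thesis
    using edge_chain_trans by blast
qed

lemma gdist_le: "edge_chain x y r \<Longrightarrow> x \<in> points \<Longrightarrow> y \<in> points \<Longrightarrow> gdist x y \<le> r"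
  unfolding gdist_def using edge_chain_nonneg
  by (auto intro!: cInf_lower bdd_belowI[of _ 0])

lemma gdist_segment:
  "s \<in> {0..w e} \<Longrightarrow> t \<in> {0..w e} \<Longrightarrow> gdist (edge_point e s) (edge_point e t) \<le> \<bar>s - t\<bar>"
  by (intro gdist_le edge_chain_segment edge_point_in_points)

text \<open>
  The universal property of the quotient metric: it is the largest pseudometric for which every
  edge is parametrized without stretching. All lower bounds for distances are obtained from it by a suitable
  choice of \<open>D\<close>.
\<close>

lemma gdist_greatest:
  assumes "\<And>x. D x x \<le> 0" "\<And>x y z. D x z \<le> D x y + D y z"
    and "\<And>e s t. s \<in> {0..w e} \<Longrightarrow> t \<in> {0..w e} \<Longrightarrow> D (edge_point e s) (edge_point e t) \<le> \<bar>s - t\<bar>"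
    and "x \<in> points" "y \<in> points"
  shows "D x y \<le> gdist x y"
proof -
  have "D x y \<le> r" if "edge_chain x y r" for r x y
    using that
  proof (induction rule: edge_chain.induct)
    case (step s e t y r)
    then show ?case using assms(2)[of "edge_point e s" y "edge_point e t"] assms(3)[of s e t]
      by simp
  qed (use assms(1) in auto)
  then show ?thesis
    unfolding gdist_def using assms edge_chain_exists[of x y]
    by (auto intro!: cInf_greatest)
qed

text \<open>
  The angle of \<open>collapse e p\<close>, measured in turns and taken in \<open>[0, 1)\<close> for \<open>p\<close> in \<open>points\<close>.
\<close>

definition coord :: "'e \<Rightarrow> ('v, 'e) graph_point \<Rightarrow> real" where
  "coord e p = (case p of Vertex _ \<Rightarrow> 0 | Interior e' t \<Rightarrow> if e' = e then t / w e else 0)"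

lemma collapse_eq_cis_coord: "collapse e p = cis (2 * pi * coord e p)"
  by (auto simp: collapse_def coord_def split: graph_point.split)

lemma coord_edge_point:
  "coord e' (edge_point e s) = (if e' = e then s / w e - (if s = w e then 1 else 0) else 0)"
  by (auto simp: coord_def edge_point_def)

lemma collapse_edge_point:
  "collapse e' (edge_point e s) = (if e' = e then cis (2 * pi * (s / w e)) else 1)"
  by (simp add: collapse_eq_cis_coord coord_edge_point right_diff_distrib flip: cis_divide)

text \<open>
  Inside one closed edge only one summand changes, and it changes by at most the distance travelled.
\<close>

lemma sum_int_dist_coord_le_gdist:
  assumes "x \<in> points" "y \<in> points"
  shows "(\<Sum>e\<in>UNIV. w e * int_dist (coord e x - coord e y)) \<le> gdist x y"
proof (rule gdist_greatest[OF _ _ _ assms])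
  fix x y z
  show "(\<Sum>e\<in>UNIV. w e * int_dist (coord e x - coord e z))
      \<le> (\<Sum>e\<in>UNIV. w e * int_dist (coord e x - coord e y))
        + (\<Sum>e\<in>UNIV. w e * int_dist (coord e y - coord e z))"
    unfolding sum.distrib[symmetric] distrib_left[symmetric]
  proof (intro sum_mono mult_left_mono)
    fix e show "int_dist (coord e x - coord e z)
        \<le> int_dist (coord e x - coord e y) + int_dist (coord e y - coord e z)"
      using int_dist_triangle[of "coord e x - coord e y" "coord e y - coord e z"] by simp
  qed simp
next
  fix e s t assume "s \<in> {0..w e}" "t \<in> {0..w e}"
  let ?d = "\<lambda>e'. coord e' (edge_point e s) - coord e' (edge_point e t)"
  have "(\<Sum>e'\<in>UNIV. w e' * int_dist (?d e')) = (\<Sum>e'\<in>{e}. w e' * int_dist (?d e'))"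
    by (rule sum.mono_neutral_right) (auto simp: coord_edge_point)
  also have "\<dots> = w e * int_dist (?d e)" by simp
  also have "\<dots> \<le> w e * \<bar>?d e - ((if t = w e then 1 else 0) - (if s = w e then 1 else 0))\<bar>"
    by (intro mult_left_mono int_dist_le) auto
  also have "?d e - ((if t = w e then 1 else 0) - (if s = w e then 1 else 0)) = (s - t) / w e"
    by (simp add: coord_edge_point diff_divide_distrib)
  also have "w e * \<bar>(s - t) / w e\<bar> = \<bar>s - t\<bar>"
    using weight_pos[of e] by (simp add: abs_divide)
  finally show "(\<Sum>e'\<in>UNIV. w e' * int_dist (?d e')) \<le> \<bar>s - t\<bar>" .
qed simp

lemma norm_collapse_diff_le:
  assumes "x \<in> points" "y \<in> points"
  shows "w e / (2 * pi) * cmod (collapse e x - collapse e y) \<le> gdist x y"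
proof (rule gdist_greatest[OF _ _ _ assms])
  fix x y z
  show "w e / (2 * pi) * cmod (collapse e x - collapse e z)
     \<le> w e / (2 * pi) * cmod (collapse e x - collapse e y)
      + w e / (2 * pi) * cmod (collapse e y - collapse e z)"
    unfolding distrib_left[symmetric]
    using norm_triangle_ineq[of "collapse e x - collapse e y" "collapse e y - collapse e z"]
    by (intro mult_left_mono) simp_all
next
  fix e' s t
  have "cmod (collapse e (edge_point e' s) - collapse e (edge_point e' t)) \<le> 2 * pi * \<bar>s - t\<bar> / w e"
  proof (cases "e = e'")
    case True
    have "cmod (cis (2 * pi * (s / w e)) - cis (2 * pi * (t / w e))) \<le> \<bar>2 * pi * (s / w e) - 2 * pi * (t / w e)\<bar>"
      by (rule norm_cis_diff_le)
    also have "\<dots> = \<bar>2 * pi * (s - t) / w e\<bar>" by (simp add: algebra_simps diff_divide_distrib)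
    finally show ?thesis using True by (simp add: collapse_edge_point abs_mult abs_divide)
  qed (simp add: collapse_edge_point)
  then show "w e / (2 * pi) * cmod (collapse e (edge_point e' s) - collapse e (edge_point e' t)) \<le> \<bar>s - t\<bar>"
    using weight_pos[of e] by (simp add: field_simps)
qed simp

text \<open>
  Vertices all have the same coordinates, so the coordinates do not separate them. The function \<open>f\<close> of the proof does: it vanishes
  at \<open>v\<close>, equals the least weight \<open>m\<close> at the other vertices, and is extended to each edge as the largest function of
  Lipschitz constant 1 with these boundary values.
\<close>

lemma gdist_vertices_pos:
  assumes "u \<noteq> v"
  shows "0 < gdist (Vertex u) (Vertex v)"
proof -
  define m where "m = Min (range w)"
  have m: "m \<le> w e" for e by (simp add: m_def)
  have m0: "0 < m" using weight_pos by (auto simp: m_def)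
  define F where "F x = (if x = v then 0 else m)" for x
  have F: "0 \<le> F x" "F x \<le> w e" for x e using m[of e] m0 by (auto simp: F_def)
  define g where "g e s = min (s + F (src e)) (w e - s + F (tgt e))" for e s
  define f where "f p = (case p of Vertex x \<Rightarrow> F x | Interior e t \<Rightarrow> g e t)" for p
  have f_edge: "f (edge_point e s) = g e s" for e s
    using F(1)[of "tgt e"] F(2)[of "src e" e] F(1)[of "src e"] F(2)[of "tgt e" e]
    by (auto simp: f_def g_def edge_point_def)
  have "\<bar>f (Vertex u) - f (Vertex v)\<bar> \<le> gdist (Vertex u) (Vertex v)"
  proof (rule gdist_greatest)
    fix e s t show "\<bar>f (edge_point e s) - f (edge_point e t)\<bar> \<le> \<bar>s - t\<bar>"
      by (auto simp: f_edge g_def min_def)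
  qed auto
  then show ?thesis using m0 assms by (simp add: f_def F_def)
qed

sublocale Metric_space points gdist
proof
  fix x y z
  show gdist_nonneg: "0 \<le> gdist x y" for x y
    using gdist_greatest[of "\<lambda>_ _. 0" x y] by (auto simp: gdist_def)
  have "{r. edge_chain x y r} = {r. edge_chain y x r}" using edge_chain_sym by blast
  then show "gdist x y = gdist y x" by (simp add: gdist_def conj_commute)
  assume x: "x \<in> points" and y: "y \<in> points"
  show "gdist x y = 0 \<longleftrightarrow> x = y"
  proof
    assume "x = y"
    then show "gdist x y = 0"
      using gdist_le[OF edge_chain.refl x x] gdist_nonneg[of x x] by simp
  next
    assume 0: "gdist x y = 0"
    have "w e * int_dist (coord e x - coord e y) = 0" for e
    proof -
      have "(\<Sum>e\<in>UNIV. w e * int_dist (coord e x - coord e y)) = 0"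
        using sum_int_dist_coord_le_gdist[OF x y] 0 by (intro antisym sum_nonneg) auto
      then show ?thesis by (subst (asm) sum_nonneg_eq_0_iff) auto
    qed
    then have int: "coord e x - coord e y \<in> \<int>" for e
      by (simp add: int_dist_def) (metis Ints_of_int)
    have bnd: "0 \<le> coord e z" "coord e z < 1" if "z \<in> points" for e z
      using that weight_pos by (auto simp: points_def coord_def)
    have eq: "coord e x = coord e y" for e
    proof -
      obtain k where k: "coord e x - coord e y = of_int k" using int[of e] by (elim Ints_cases)
      with bnd[OF x, of e] bnd[OF y, of e] have "\<bar>real_of_int k\<bar> < 1" by linarith
      then have "k = 0" by linarith
      with k show ?thesis by simp
    qed
    have interior: "z = Interior e t \<longleftrightarrow> coord e z = t / w e" if "z \<in> points" "0 < t" for z e t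
      using that by (auto simp: coord_def points_def split: if_splits)
    show "x = y"
    proof (cases x)
      case (Interior e t)
      with x have "0 < t" by (auto simp: points_def)
      then show ?thesis using interior[OF x] interior[OF y] eq[of e] Interior by metis
    next
      case x': (Vertex u)
      show ?thesis
      proof (cases y)
        case (Interior e t)
        with y have "0 < t" by (auto simp: points_def)
        then show ?thesis using interior[OF x] interior[OF y] eq[of e] Interior by metis
      next
        case (Vertex v)
        then show ?thesis using x' 0 gdist_vertices_pos[of u v] by force
      qed
    qed
  qed
  assume z: "z \<in> points"
  show "gdist x z \<le> gdist x y + gdist y z"
  proof (rule field_le_epsilon)
    fix \<epsilon> :: real assume \<epsilon>: "0 < \<epsilon>"
    have *: "\<exists>r. edge_chain x y r \<and> r < gdist x y + \<epsilon>/2" if "x \<in> points" "y \<in> points" for x y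
      using cInf_lessD[of "{r. edge_chain x y r}" "gdist x y + \<epsilon>/2"] edge_chain_exists[OF that] \<epsilon> that
      by (auto simp: gdist_def)
    from *[OF x y] *[OF y z] obtain r r' where r: "edge_chain x y r" "r < gdist x y + \<epsilon>/2"
      "edge_chain y z r'" "r' < gdist y z + \<epsilon>/2" by blast
    then show "gdist x z \<le> gdist x y + gdist y z + \<epsilon>"
      using gdist_le[OF edge_chain_trans[OF r(1,3)] x z] by simp
  qed
qed

section \<open>Lengths and homology classes of curves\<close>

definition wnorm :: "real ^ 'e \<Rightarrow> real" where
  "wnorm u = (\<Sum>e\<in>UNIV. w e * \<bar>u $ e\<bar>)"

lemma path_collapse_curve:
  assumes "pathin mtopology \<gamma>"
  shows "path (collapse e \<circ> \<gamma>)"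
proof -
  have cm: "continuous_map (top_of_set {0..1}) mtopology \<gamma>"
    using assms by (simp add: pathin_def)
  have "continuous_map (top_of_set {0..1}) Met_TC.mtopology (collapse e \<circ> \<gamma>)"
    unfolding Met_TC.continuous_map_to_metric
  proof (intro ballI allI impI)
    fix x \<epsilon> :: real assume x: "x \<in> topspace (top_of_set {0..1})" and \<epsilon>: "0 < \<epsilon>"
    define \<delta> where "\<delta> = w e / (2 * pi) * \<epsilon>"
    have "0 < \<delta>" using \<epsilon> weight_pos by (simp add: \<delta>_def)
    then obtain U where U: "openin (top_of_set {0..1}) U" "x \<in> U" "\<forall>y\<in>U. \<gamma> y \<in> mball (\<gamma> x) \<delta>"
      using cm x unfolding continuous_map_to_metric by blast
    have "(collapse e \<circ> \<gamma>) y \<in> Met_TC.mball ((collapse e \<circ> \<gamma>) x) \<epsilon>" if "y \<in> U" for y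
    proof -
      have "\<gamma> x \<in> points" "\<gamma> y \<in> points" "gdist (\<gamma> x) (\<gamma> y) < \<delta>" using U that by auto
      with norm_collapse_diff_le[of "\<gamma> x" "\<gamma> y" e]
      have "w e / (2 * pi) * cmod (collapse e (\<gamma> x) - collapse e (\<gamma> y)) < w e / (2 * pi) * \<epsilon>"
        by (simp add: \<delta>_def)
      then show ?thesis using weight_pos[of e] by (simp add: dist_norm mult_less_cancel_left divide_simps)
    qed
    with U show "\<exists>U. openin (top_of_set {0..1}) U \<and> x \<in> U \<and>
        (\<forall>y\<in>U. (collapse e \<circ> \<gamma>) y \<in> Met_TC.mball ((collapse e \<circ> \<gamma>) x) \<epsilon>)" by blast
  qed
  then show ?thesis
    by (simp add: path_def)
qed

text \<open>
  The lift of a curve to the universal cover of the circle belonging to \<open>e\<close>; its total increment is the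
  winding number.
\<close>

lemma homology_class_lift:
  assumes "pathin mtopology \<gamma>"
  obtains \<theta> where "continuous_on {0..1} \<theta>"
    "\<And>t. t \<in> {0..1} \<Longrightarrow> \<theta> t - coord e (\<gamma> t) \<in> \<int>"
    "\<theta> 1 - \<theta> 0 = homology_class \<gamma> $ e"
proof -
  have "path (collapse e \<circ> \<gamma>)" using assms by (rule path_collapse_curve)
  moreover have "0 \<notin> path_image (collapse e \<circ> \<gamma>)"
    by (auto simp: path_image_def collapse_eq_cis_coord)
  ultimately obtain q where q: "path q"
    "pathfinish q - pathstart q = 2 * of_real pi * \<i> * winding_number (collapse e \<circ> \<gamma>) 0"
    "\<And>t. t \<in> {0..1} \<Longrightarrow> (collapse e \<circ> \<gamma>) t = 0 + exp (q t)"
    using winding_number_as_continuous_log by metis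
  show ?thesis
  proof
    show "continuous_on {0..1} (\<lambda>t. Im (q t) / (2 * pi))"
      using q(1) by (auto simp: path_def intro!: continuous_intros)
    show "Im (q t) / (2 * pi) - coord e (\<gamma> t) \<in> \<int>" if "t \<in> {0..1}" for t
    proof -
      have eq: "exp (q t) = cis (2 * pi * coord e (\<gamma> t))"
        using q(3)[OF that] by (simp add: collapse_eq_cis_coord)
      then have "exp (Re (q t)) = 1"
        by (metis norm_cis norm_exp_eq_Re)
      with eq have "cis (2 * pi * (Im (q t) / (2 * pi))) = cis (2 * pi * coord e (\<gamma> t))"
        by (simp add: exp_eq_polar)
      then show ?thesis unfolding cis_2pi_eq_iff .
    qed
    have "Im (q 1) - Im (q 0) = 2 * pi * Re (winding_number (collapse e \<circ> \<gamma>) 0)"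
      using arg_cong[OF q(2), of Im] by (simp add: pathfinish_def pathstart_def)
    then show "Im (q 1) / (2 * pi) - Im (q 0) / (2 * pi) = homology_class \<gamma> $ e"
      by (simp add: homology_class_def field_simps)
  qed
qed

text \<open>
  By uniform continuity a sufficiently fine subdivision moves all the lifts by less than half a turn per step. Then
  the length of the inscribed polygon dominates the total variation of the lifts along the subdivision, weighted by \<open>w\<close>,
  and hence also their total increments.
\<close>

lemma wnorm_le_curve_length:
  assumes "pathin mtopology \<gamma>"
  shows "ennreal (wnorm (homology_class \<gamma>)) \<le> curve_length \<gamma>"
proof -
  have pts: "\<gamma> t \<in> points" if "t \<in> {0..1}" for t
    using assms that by (force simp: continuous_map_def pathin_def)
  have "\<exists>\<theta>. continuous_on {0..1} \<theta> \<and> (\<forall>t\<in>{0..1}. \<theta> t - coord e (\<gamma> t) \<in> \<int>)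
          \<and> \<theta> 1 - \<theta> 0 = homology_class \<gamma> $ e" for e
    using homology_class_lift[OF assms, of e] by metis
  then obtain \<theta> where \<theta>: "\<And>e. continuous_on {0..1} (\<theta> e)"
    "\<And>e t. t \<in> {0..1} \<Longrightarrow> \<theta> e t - coord e (\<gamma> t) \<in> \<int>"
    "\<And>e. \<theta> e 1 - \<theta> e 0 = homology_class \<gamma> $ e"
    by metis
  have "\<exists>\<delta>>0. \<forall>s\<in>{0..1}. \<forall>t\<in>{0..1}. dist s t < \<delta> \<longrightarrow> dist (\<theta> e s) (\<theta> e t) < 1/2" for e
  proof -
    have "uniformly_continuous_on {0..1} (\<theta> e)"
      by (intro compact_uniformly_continuous \<theta>) simp
    then show ?thesis unfolding uniformly_continuous_on_def
      by (metis dist_commute half_gt_zero zero_less_one)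
  qed
  then obtain \<delta> where \<delta>: "\<And>e. 0 < \<delta> e"
    "\<And>e s t. s \<in> {0..1} \<Longrightarrow> t \<in> {0..1} \<Longrightarrow> dist s t < \<delta> e \<Longrightarrow> dist (\<theta> e s) (\<theta> e t) < 1/2"
    by metis
  have "0 < Min (range \<delta>)" using \<delta>(1) by auto
  then obtain m where m: "inverse (real (Suc m)) < Min (range \<delta>)"
    using reals_Archimedean by blast
  define n where "n = Suc m"
  \<comment> \<open>The cut-off at \<open>1\<close> keeps the subdivision points beyond index \<open>n\<close> in the unit interval.\<close>
  define t where "t i = min (real i / real n) 1" for i
  have n: "0 < n" by (simp add: n_def)
  have t01: "t i \<in> {0..1}" for i by (simp add: t_def)
  have "mono t" by (auto simp: mono_def t_def divide_right_mono min_le_iff_disj)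
  have t0: "t 0 = 0" and tn: "t n = 1" using n by (simp_all add: t_def)
  have step: "dist (t (Suc i)) (t i) < \<delta> e" for i e
  proof -
    have "dist (t (Suc i)) (t i) \<le> inverse (real n)"
      using n by (auto simp: t_def dist_real_def min_def field_simps)
    also have "\<dots> < \<delta> e" using m by (simp add: n_def)
    finally show ?thesis .
  qed
  have seg: "(\<Sum>e\<in>UNIV. w e * \<bar>\<theta> e (t (Suc i)) - \<theta> e (t i)\<bar>) \<le> gdist (\<gamma> (t i)) (\<gamma> (t (Suc i)))" for i
  proof -
    have "int_dist (coord e (\<gamma> (t (Suc i))) - coord e (\<gamma> (t i))) = \<bar>\<theta> e (t (Suc i)) - \<theta> e (t i)\<bar>" for e
    proof (rule int_dist_eq_abs)
      show "\<bar>\<theta> e (t (Suc i)) - \<theta> e (t i)\<bar> < 1 / 2"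
        using \<delta>(2)[OF t01 t01 step] by (simp add: dist_real_def)
      have "(\<theta> e (t (Suc i)) - coord e (\<gamma> (t (Suc i)))) - (\<theta> e (t i) - coord e (\<gamma> (t i))) \<in> \<int>"
        by (intro Ints_diff \<theta> t01)
      then show "\<theta> e (t (Suc i)) - \<theta> e (t i) - (coord e (\<gamma> (t (Suc i))) - coord e (\<gamma> (t i))) \<in> \<int>"
        by (simp add: algebra_simps)
    qed
    then show ?thesis
      using sum_int_dist_coord_le_gdist[OF pts[OF t01[of "Suc i"]] pts[OF t01[of i]]]
      by (simp add: commute)
  qed
  have tel: "(\<Sum>i<n. \<theta> e (t (Suc i)) - \<theta> e (t i)) = homology_class \<gamma> $ e" for e
    using sum_lessThan_telescope[of "\<lambda>i. \<theta> e (t i)" n] by (simp add: t0 tn \<theta>(3))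
  have "wnorm (homology_class \<gamma>) = (\<Sum>e\<in>UNIV. w e * \<bar>\<Sum>i<n. \<theta> e (t (Suc i)) - \<theta> e (t i)\<bar>)"
    by (simp add: wnorm_def tel)
  also have "\<dots> \<le> (\<Sum>e\<in>UNIV. w e * (\<Sum>i<n. \<bar>\<theta> e (t (Suc i)) - \<theta> e (t i)\<bar>))"
    by (intro sum_mono mult_left_mono sum_abs) simp
  also have "\<dots> = (\<Sum>i<n. \<Sum>e\<in>UNIV. w e * \<bar>\<theta> e (t (Suc i)) - \<theta> e (t i)\<bar>)"
    unfolding sum_distrib_left by (rule sum.swap)
  also have "\<dots> \<le> (\<Sum>i<n. gdist (\<gamma> (t i)) (\<gamma> (t (Suc i))))"
    by (intro sum_mono seg)
  finally have "ennreal (wnorm (homology_class \<gamma>)) \<le> (\<Sum>i<n. ennreal (gdist (\<gamma> (t i)) (\<gamma> (t (Suc i)))))"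
    by (simp add: ennreal_leI sum_ennreal)
  also have "\<dots> \<le> curve_length \<gamma>"
    unfolding curve_length_def
    by (rule SUP_upper2[of "(n, t)"]) (use \<open>mono t\<close> t01 in auto)
  finally show ?thesis .
qed

lemma curve_length_le_Lipschitz:
  assumes "\<And>s t. 0 \<le> s \<Longrightarrow> s \<le> t \<Longrightarrow> t \<le> 1 \<Longrightarrow> gdist (\<gamma> s) (\<gamma> t) \<le> L * (t - s)" "0 \<le> L"
  shows "curve_length \<gamma> \<le> ennreal L"
  unfolding curve_length_def
proof (rule SUP_least, clarify)
  fix n and t :: "nat \<Rightarrow> real" assume "mono t" and t: "range t \<subseteq> {0..1}"
  have t01: "0 \<le> t i" "t i \<le> 1" for i using t by (auto simp: image_subset_iff)
  have "(\<Sum>i<n. gdist (\<gamma> (t i)) (\<gamma> (t (Suc i)))) \<le> (\<Sum>i<n. L * (t (Suc i) - t i))"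
    by (intro sum_mono assms t01 monoD[OF \<open>mono t\<close>]) simp
  also have "\<dots> = L * (t n - t 0)"
    by (simp add: sum_lessThan_telescope flip: sum_distrib_left)
  also have "\<dots> \<le> L * 1"
    using t01[of n] t01[of 0] assms(2) by (intro mult_left_mono) auto
  finally show "(\<Sum>i<n. ennreal (gdist (\<gamma> (t i)) (\<gamma> (t (Suc i))))) \<le> ennreal L"
    by (simp add: sum_ennreal ennreal_leI)
qed

lemma pathin_Lipschitz:
  assumes L: "\<And>s t. 0 \<le> s \<Longrightarrow> s \<le> t \<Longrightarrow> t \<le> 1 \<Longrightarrow> gdist (\<gamma> s) (\<gamma> t) \<le> L * (t - s)" "0 \<le> L"
    and pts: "\<And>t. t \<in> {0..1} \<Longrightarrow> \<gamma> t \<in> points"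
  shows "pathin mtopology \<gamma>"
  unfolding pathin_def continuous_map_to_metric
proof (intro ballI allI impI)
  fix x \<epsilon> :: real assume "x \<in> topspace (top_of_set {0..1})" and \<epsilon>: "0 < \<epsilon>"
  then have x: "x \<in> {0..1}" by simp
  define \<delta> where "\<delta> = \<epsilon> / (L + 1)"
  have \<delta>: "0 < \<delta>" using \<epsilon> L(2) by (simp add: \<delta>_def)
  have "gdist (\<gamma> x) (\<gamma> y) < \<epsilon>" if "y \<in> {0..1} \<inter> ball x \<delta>" for y
  proof -
    have "gdist (\<gamma> x) (\<gamma> y) \<le> L * \<bar>x - y\<bar>"
      using L(1)[of x y] L(1)[of y x] x that
      by (cases "x \<le> y") (auto simp: commute)
    also have "\<dots> \<le> L * \<delta>"
      using that L(2) by (intro mult_left_mono) (auto simp: dist_real_def)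
    also have "\<dots> < \<epsilon>" using \<epsilon> L(2) by (simp add: \<delta>_def field_simps)
    finally show ?thesis .
  qed
  then show "\<exists>U. openin (top_of_set {0..1}) U \<and> x \<in> U \<and> (\<forall>y\<in>U. \<gamma> y \<in> mball (\<gamma> x) \<epsilon>)"
    using x \<delta> pts by (intro exI[of _ "{0..1} \<inter> ball x \<delta>"]) (auto simp: openin_open_Int)
qed

lemma homology_class_eqI:
  fixes v :: "real ^ 'e"
  assumes "\<And>e. continuous_on {0..1} (\<theta> e)"
    and "\<And>e t. t \<in> {0..1} \<Longrightarrow> collapse e (\<gamma> t) = cis (2 * pi * \<theta> e t)"
    and "\<And>e. \<theta> e 1 - \<theta> e 0 = v $ e"
  shows "homology_class \<gamma> = v"
proof -
  have "Re (winding_number (collapse e \<circ> \<gamma>) 0) = v $ e" for e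
  proof -
    define p where "p t = 2 * of_real pi * \<i> * complex_of_real (\<theta> e t)" for t
    have "path p" unfolding path_def p_def by (intro continuous_intros assms)
    have "winding_number (collapse e \<circ> \<gamma>) 0 = winding_number (exp \<circ> p) 0"
    proof (rule winding_number_cong)
      fix t :: real assume "0 \<le> t" "t \<le> 1"
      then show "(collapse e \<circ> \<gamma>) t = (exp \<circ> p) t"
        using assms(2)[of t e] by (simp add: p_def cis_conv_exp mult_ac)
    qed
    also have "\<dots> = (pathfinish p - pathstart p) / (2 * of_real pi * \<i>)"
      by (rule winding_number_compose_exp) fact
    also have "\<dots> = complex_of_real (\<theta> e 1 - \<theta> e 0)"
      by (simp add: p_def pathfinish_def pathstart_def field_simps)
    finally show ?thesis using assms(3) by simp
  qed
  then show ?thesis by (simp add: homology_class_def vec_eq_iff)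
qed

section \<open>Walks and the curves that run along them\<close>

fun walk :: "'v \<Rightarrow> ('e \<times> bool) list \<Rightarrow> 'v \<Rightarrow> bool" where
  "walk x [] y \<longleftrightarrow> x = y"
| "walk x (a # p) y \<longleftrightarrow> tail a = x \<and> walk (head a) p y"

definition walk_length :: "('e \<times> bool) list \<Rightarrow> real" where
  "walk_length p = (\<Sum>a\<leftarrow>p. w (fst a))"

lemma walk_length_simps [simp]:
  "walk_length [] = 0" "walk_length (a # p) = w (fst a) + walk_length p"
  "walk_length (p @ q) = walk_length p + walk_length q"
  by (simp_all add: walk_length_def)

lemma circuit_vector_simps [simp]:
  "circuit_vector [] = 0"
  "circuit_vector (a # p) = axis (fst a) (if snd a then 1 else -1) + circuit_vector p"
  "circuit_vector (p @ q) = circuit_vector p + circuit_vector q"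
  by (simp_all add: circuit_vector_def case_prod_beta)

lemma walk_length_nonneg [simp]: "0 \<le> walk_length p"
  by (induction p) (auto intro: add_nonneg_nonneg)

lemma walk_append: "walk x (p @ q) z \<longleftrightarrow> (\<exists>y. walk x p y \<and> walk y q z)"
  by (induction p arbitrary: x) auto

definition rev_walk :: "('e \<times> bool) list \<Rightarrow> ('e \<times> bool) list" where
  "rev_walk p = rev (map (\<lambda>(e, b). (e, \<not> b)) p)"

lemma rev_walk_simps [simp]:
  "rev_walk [] = []" "rev_walk ((e, b) # p) = rev_walk p @ [(e, \<not> b)]"
  by (simp_all add: rev_walk_def)

lemma walk_rev: "walk x p y \<Longrightarrow> walk y (rev_walk p) x"
proof (induction p arbitrary: x)
  case (Cons a p)
  obtain e b where a: "a = (e, b)" by (cases a)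
  with Cons have "walk y (rev_walk p) (head a)" by simp
  then show ?case using Cons.prems by (auto simp: a walk_append tail_def head_def)
qed simp

lemma circuit_vector_rev: "circuit_vector (rev_walk p) = - circuit_vector p"
  by (induction p) (auto simp: axis_def vec_eq_iff)

lemma walk_length_rev: "walk_length (rev_walk p) = walk_length p"
  by (induction p) auto

lemma walk_repeat:
  assumes "walk x p x"
  shows "walk x (concat (replicate n p)) x"
    and "circuit_vector (concat (replicate n p)) = real n *\<^sub>R circuit_vector p"
    and "walk_length (concat (replicate n p)) = real n * walk_length p"
proof -
  show "walk x (concat (replicate n p)) x"
    using assms by (induction n) (auto simp: walk_append)
  show "circuit_vector (concat (replicate n p)) = real n *\<^sub>R circuit_vector p"
    by (induction n) (simp_all add: scaleR_add_left)
  show "walk_length (concat (replicate n p)) = real n * walk_length p"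
    by (induction n) (simp_all add: distrib_right)
qed

lemma walk_exists: "\<exists>p. walk x p y"
proof -
  have "(x, y) \<in> {(a, b). \<exists>e. (a = src e \<and> b = tgt e) \<or> (a = tgt e \<and> b = src e)}\<^sup>*"
    by (rule connected)
  then show ?thesis
  proof (induction rule: rtrancl_induct)
    case base
    have "walk x [] x" by simp
    then show ?case by blast
  next
    case (step y z)
    then obtain p e where p: "walk x p y" and "(y = src e \<and> z = tgt e) \<or> (y = tgt e \<and> z = src e)"
      by auto
    then have "tail (e, True) = y \<and> head (e, True) = z \<or> tail (e, False) = y \<and> head (e, False) = z"
      by (auto simp: tail_def head_def)
    then obtain b where "tail (e, b) = y" "head (e, b) = z" by blast
    with p have "walk x (p @ [(e, b)]) z"
      unfolding walk_append by (intro exI[of _ y]) simp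
    then show ?case by blast
  qed
qed

lemma boundary_add: "boundary (u + v) = boundary u + boundary v"
  and boundary_scaleR: "boundary (c *\<^sub>R u) = c *\<^sub>R boundary u"
  by (simp_all add: boundary_def scaleR_add_left sum.distrib scaleR_sum_right)

lemma boundary_zero [simp]: "boundary 0 = 0"
  by (simp add: boundary_def)

lemma boundary_axis: "boundary (axis e c) = c *\<^sub>R (axis (tgt e) 1 - axis (src e) 1)"
proof -
  have "boundary (axis e c) = (\<Sum>e'\<in>{e}. (axis e c $ e') *\<^sub>R (axis (tgt e') 1 - axis (src e') 1))"
    unfolding boundary_def by (rule sum.mono_neutral_right) (auto simp: axis_def)
  then show ?thesis by simp
qed

lemma boundary_walk: "walk x p y \<Longrightarrow> boundary (circuit_vector p) = axis y 1 - axis x 1"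
  by (induction p arbitrary: x) (auto simp: boundary_add boundary_axis tail_def head_def)

text \<open>
  A curve from \<open>x\<close> to \<open>y\<close> parametrized by \<open>[0, l]\<close> with speed at most 1, together with lifts
  \<open>\<theta> e\<close> of its coordinates whose increments form the chain \<open>v\<close>. The time interval varies, and open curves are admitted,
  to make concatenation simple; winding numbers and lengths can be read off at the end.
\<close>

definition track :: "'v \<Rightarrow> 'v \<Rightarrow> real ^ 'e \<Rightarrow> real \<Rightarrow> bool" where
  "track x y v l \<longleftrightarrow> 0 \<le> l \<and> (\<exists>\<gamma> \<theta>. \<gamma> 0 = Vertex x \<and> \<gamma> l = Vertex y
     \<and> (\<forall>s\<in>{0..l}. \<gamma> s \<in> points)
     \<and> (\<forall>s t. 0 \<le> s \<longrightarrow> s \<le> t \<longrightarrow> t \<le> l \<longrightarrow> gdist (\<gamma> s) (\<gamma> t) \<le> t - s)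
     \<and> (\<forall>e. continuous_on {0..l} (\<theta> e) \<and> \<theta> e 0 = 0 \<and> \<theta> e l = v $ e
            \<and> (\<forall>s\<in>{0..l}. collapse e (\<gamma> s) = cis (2 * pi * \<theta> e s))))"

lemma trackI:
  fixes v :: "real ^ 'e"
  assumes "0 \<le> l" "\<gamma> 0 = Vertex x" "\<gamma> l = Vertex y"
    and "\<And>s. s \<in> {0..l} \<Longrightarrow> \<gamma> s \<in> points"
    and "\<And>s t. 0 \<le> s \<Longrightarrow> s \<le> t \<Longrightarrow> t \<le> l \<Longrightarrow> gdist (\<gamma> s) (\<gamma> t) \<le> t - s"
    and "\<And>e. continuous_on {0..l} (\<theta> e)" "\<And>e. \<theta> e 0 = 0" "\<And>e. \<theta> e l = v $ e"
    and "\<And>e s. s \<in> {0..l} \<Longrightarrow> collapse e (\<gamma> s) = cis (2 * pi * \<theta> e s)"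
  shows "track x y v l"
  unfolding track_def using assms by blast

lemma track_refl: "track x x 0 0"
  by (rule trackI[where \<gamma> = "\<lambda>_. Vertex x" and \<theta> = "\<lambda>_ _. 0"]) (auto simp: collapse_def)

lemma track_arc:
  "track (tail a) (head a) (axis (fst a) (if snd a then 1 else -1)) (w (fst a))"
proof -
  obtain e b where a: "a = (e, b)" by (cases a)
  define r where "r s = (if b then s else w e - s)" for s
  define \<gamma> where "\<gamma> s = edge_point e (r s)" for s
  define \<theta> where "\<theta> e' s = (if e' = e then (if b then s else - s) / w e else 0)" for e' s
  have r: "r s \<in> {0..w e} \<longleftrightarrow> s \<in> {0..w e}" for s by (auto simp: r_def)
  have "track (tail a) (head a) (axis e (if b then 1 else -1)) (w e)"
  proof (rule trackI[where \<gamma> = \<gamma> and \<theta> = \<theta>])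
    fix s t assume st: "0 \<le> s" "s \<le> t" "t \<le> w e"
    have "gdist (\<gamma> s) (\<gamma> t) \<le> \<bar>r s - r t\<bar>"
      unfolding \<gamma>_def using st by (intro gdist_segment) (simp_all only: r, simp_all)
    also have "\<dots> = t - s" using st by (simp add: r_def)
    finally show "gdist (\<gamma> s) (\<gamma> t) \<le> t - s" .
  next
    fix s assume "s \<in> {0..w e}"
    then show "\<gamma> s \<in> points"
      using r edge_point_in_points unfolding \<gamma>_def by blast
  next
    fix e' s
    have "cis (2 * pi * (r s / w e)) = cis (2 * pi * \<theta> e s)"
      unfolding cis_2pi_eq_iff by (simp add: r_def \<theta>_def diff_divide_distrib)
    then show "collapse e' (\<gamma> s) = cis (2 * pi * \<theta> e' s)"
      by (simp add: \<gamma>_def collapse_edge_point) (simp add: \<theta>_def)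
  next
    fix e'
    show "continuous_on {0..w e} (\<theta> e')"
    proof (cases "e' = e")
      case True
      then show ?thesis unfolding \<theta>_def by (cases b) (auto intro!: continuous_intros)
    qed (simp add: \<theta>_def)
  qed (simp_all add: \<gamma>_def \<theta>_def r_def a tail_def head_def axis_def)
  then show ?thesis by (simp add: a)
qed

lemma track_trans:
  assumes "track x y v l" "track y z v' l'"
  shows "track x z (v + v') (l + l')"
proof -
  from assms(1) obtain \<gamma> \<theta> where l: "0 \<le> l"
    and \<gamma>: "\<gamma> 0 = Vertex x" "\<gamma> l = Vertex y" "\<And>s. s \<in> {0..l} \<Longrightarrow> \<gamma> s \<in> points"
      "\<And>s t. 0 \<le> s \<Longrightarrow> s \<le> t \<Longrightarrow> t \<le> l \<Longrightarrow> gdist (\<gamma> s) (\<gamma> t) \<le> t - s"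
    and \<theta>: "\<And>e. continuous_on {0..l} (\<theta> e)" "\<And>e. \<theta> e 0 = 0" "\<And>e. \<theta> e l = v $ e"
      "\<And>e s. s \<in> {0..l} \<Longrightarrow> collapse e (\<gamma> s) = cis (2 * pi * \<theta> e s)"
    unfolding track_def by blast
  from assms(2) obtain \<gamma>' \<theta>' where l': "0 \<le> l'"
    and \<gamma>': "\<gamma>' 0 = Vertex y" "\<gamma>' l' = Vertex z" "\<And>s. s \<in> {0..l'} \<Longrightarrow> \<gamma>' s \<in> points"
      "\<And>s t. 0 \<le> s \<Longrightarrow> s \<le> t \<Longrightarrow> t \<le> l' \<Longrightarrow> gdist (\<gamma>' s) (\<gamma>' t) \<le> t - s"
    and \<theta>': "\<And>e. continuous_on {0..l'} (\<theta>' e)" "\<And>e. \<theta>' e 0 = 0" "\<And>e. \<theta>' e l' = v' $ e"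
      "\<And>e s. s \<in> {0..l'} \<Longrightarrow> collapse e (\<gamma>' s) = cis (2 * pi * \<theta>' e s)"
    unfolding track_def by blast
  define \<beta> where "\<beta> s = (if s \<le> l then \<gamma> s else \<gamma>' (s - l))" for s
  define \<phi> where "\<phi> e s = (if s \<le> l then \<theta> e s else v $ e + \<theta>' e (s - l))" for e s
  have \<beta>': "\<beta> s = \<gamma>' (s - l)" if "l \<le> s" for s
    using that \<gamma>(2) \<gamma>'(1) by (auto simp: \<beta>_def)
  have \<phi>': "\<phi> e s = v $ e + \<theta>' e (s - l)" if "l \<le> s" for e s
    using that \<theta>(3) \<theta>'(2) by (auto simp: \<phi>_def)
  have pts: "\<beta> s \<in> points" if "s \<in> {0..l + l'}" for s
    using that \<gamma>(3) \<gamma>'(3) by (auto simp: \<beta>_def)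
  show ?thesis
  proof (rule trackI[where \<gamma> = \<beta> and \<theta> = \<phi>])
    fix s t assume st: "0 \<le> s" "s \<le> t" "t \<le> l + l'"
    consider "t \<le> l" | "l \<le> s" | "s < l" "l < t" by linarith
    then show "gdist (\<beta> s) (\<beta> t) \<le> t - s"
    proof cases
      case 1
      then show ?thesis using \<gamma>(4)[of s t] st by (simp add: \<beta>_def)
    next
      case 2
      then show ?thesis using \<gamma>'(4)[of "s - l" "t - l"] st by (simp add: \<beta>')
    next
      case 3
      have "gdist (\<beta> s) (\<beta> t) \<le> gdist (\<beta> s) (\<beta> l) + gdist (\<beta> l) (\<beta> t)"
        using st l l' 3 by (intro triangle pts) auto
      also have "gdist (\<beta> s) (\<beta> l) \<le> l - s"
        using 3 st \<gamma>(4)[of s l] by (simp add: \<beta>_def)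
      also have "gdist (\<beta> l) (\<beta> t) \<le> t - l"
        using 3 st \<gamma>'(4)[of 0 "t - l"] by (simp add: \<beta>')
      finally show ?thesis by simp
    qed
  next
    fix e
    have "continuous_on ({0..l} \<union> {l..l + l'}) (\<phi> e)"
    proof (rule continuous_on_closed_Un)
      show "continuous_on {0..l} (\<phi> e)"
        using \<theta>(1)[of e] by (rule continuous_on_eq) (simp add: \<phi>_def)
      have "continuous_on {l..l + l'} (\<lambda>s. v $ e + \<theta>' e (s - l))"
        by (intro continuous_intros continuous_on_compose2[OF \<theta>'(1)[of e]]) auto
      then show "continuous_on {l..l + l'} (\<phi> e)"
        by (rule continuous_on_eq) (simp add: \<phi>')
    qed auto
    moreover have "{0..l} \<union> {l..l + l'} = {0..l + l'}" using l l' by auto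
    ultimately show "continuous_on {0..l + l'} (\<phi> e)" by simp
  next
    fix e s assume s: "s \<in> {0..l + l'}"
    show "collapse e (\<beta> s) = cis (2 * pi * \<phi> e s)"
    proof (cases "s \<le> l")
      case True
      then show ?thesis using s \<theta>(4)[of s e] by (simp add: \<beta>_def \<phi>_def)
    next
      case False
      have "cis (2 * pi * v $ e) = 1"
        using \<theta>(4)[of l e] l \<gamma>(2) \<theta>(3)[of e] by (simp add: collapse_def)
      then show ?thesis
        using False s \<theta>'(4)[of "s - l" e]
        by (simp add: \<beta>_def \<phi>_def distrib_left flip: cis_mult)
    qed
  next
    show "\<beta> (l + l') = Vertex z" using \<beta>'[of "l + l'"] l' \<gamma>'(2) by simp
    show "\<phi> e (l + l') = (v + v') $ e" for e using \<phi>'[of "l + l'" e] l' \<theta>'(3) by simp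
  qed (use l l' pts \<gamma>(1) \<theta>(2) in \<open>auto simp: \<beta>_def[of 0] \<phi>_def[of _ 0]\<close>)
qed

lemma track_walk: "walk x p y \<Longrightarrow> track x y (circuit_vector p) (walk_length p)"
proof (induction p arbitrary: x)
  case (Cons a p)
  then show ?case using track_trans[OF track_arc[of a]] by auto
qed (simp add: track_refl)

text \<open>
  The lower bound needs the walk as well: without any curve in the class, the infimum is \<open>\<infinity>\<close> and its
  value as a real number is \<open>0\<close>.
\<close>

lemma shortest_length_bounds:
  assumes "walk x p x"
  shows "wnorm (circuit_vector p) \<le> shortest_length (circuit_vector p)"
    and "shortest_length (circuit_vector p) \<le> walk_length p"
proof -
  let ?v = "circuit_vector p" and ?l = "walk_length p"
  let ?I = "INF \<gamma> \<in> {\<gamma>. closed_curve \<gamma> \<and> homology_class \<gamma> = ?v}. curve_length \<gamma>"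
  obtain \<gamma> \<theta> where l: "0 \<le> ?l"
    and \<gamma>: "\<gamma> 0 = Vertex x" "\<gamma> ?l = Vertex x" "\<And>s. s \<in> {0..?l} \<Longrightarrow> \<gamma> s \<in> points"
      "\<And>s t. 0 \<le> s \<Longrightarrow> s \<le> t \<Longrightarrow> t \<le> ?l \<Longrightarrow> gdist (\<gamma> s) (\<gamma> t) \<le> t - s"
    and \<theta>: "\<And>e. continuous_on {0..?l} (\<theta> e)" "\<And>e. \<theta> e 0 = 0" "\<And>e. \<theta> e ?l = ?v $ e"
      "\<And>e s. s \<in> {0..?l} \<Longrightarrow> collapse e (\<gamma> s) = cis (2 * pi * \<theta> e s)"
    using track_walk[OF assms] unfolding track_def by blast
  define \<beta> where "\<beta> t = \<gamma> (?l * t)" for t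
  have lt: "?l * t \<in> {0..?l}" if "t \<in> {0..1}" for t
    using that l by (simp add: mult_left_le)
  have lip: "gdist (\<beta> s) (\<beta> t) \<le> ?l * (t - s)" if "0 \<le> s" "s \<le> t" "t \<le> 1" for s t
    using \<gamma>(4)[of "?l * s" "?l * t"] that l
    by (simp add: \<beta>_def right_diff_distrib mult_left_mono mult_left_le)
  have "pathin mtopology \<beta>"
    using lip l by (rule pathin_Lipschitz) (auto simp: \<beta>_def intro!: \<gamma>(3) mult_left_le)
  then have "closed_curve \<beta>"
    by (simp add: closed_curve_def \<beta>_def \<gamma>(1,2))
  moreover have "homology_class \<beta> = ?v"
  proof (rule homology_class_eqI[where \<theta> = "\<lambda>e t. \<theta> e (?l * t)"])
    show "continuous_on {0..1} (\<lambda>t. \<theta> e (?l * t))" for e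
      by (rule continuous_on_compose2[OF \<theta>(1)[of e]]) (use lt in \<open>auto intro!: continuous_intros\<close>)
  qed (use lt \<theta> in \<open>simp_all add: \<beta>_def\<close>)
  moreover have "curve_length \<beta> \<le> ennreal ?l"
    using lip l by (rule curve_length_le_Lipschitz)
  ultimately have upper: "?I \<le> ennreal ?l"
    by (intro INF_lower2[of \<beta>]) auto
  have lower: "ennreal (wnorm ?v) \<le> ?I"
    by (rule INF_greatest) (metis (mono_tags) mem_Collect_eq closed_curve_def wnorm_le_curve_length)
  have "0 \<le> wnorm ?v" by (simp add: wnorm_def sum_nonneg)
  then show "wnorm ?v \<le> shortest_length ?v"
    unfolding shortest_length_def using enn2real_mono[OF lower] upper
    by (simp add: le_less_trans)
  show "shortest_length ?v \<le> ?l"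
    unfolding shortest_length_def using enn2real_mono[OF upper] l by simp
qed

section \<open>Decomposing cycles into simple circuits\<close>

lemma H1_add: "u \<in> H1 \<Longrightarrow> v \<in> H1 \<Longrightarrow> u + v \<in> H1"
  and H1_scaleR: "u \<in> H1 \<Longrightarrow> c *\<^sub>R u \<in> H1"
  and H1_zero [simp]: "0 \<in> H1"
  by (simp_all add: H1_def boundary_add boundary_scaleR)

lemma H1_sum: "(\<And>i. i \<in> S \<Longrightarrow> f i \<in> H1) \<Longrightarrow> (\<Sum>i\<in>S. f i) \<in> H1"
  by (induction S rule: infinite_finite_induct) (auto intro: H1_add)

lemma wnorm_nonneg [simp]: "0 \<le> wnorm u"
  by (simp add: wnorm_def sum_nonneg)

lemma wnorm_zero [simp]: "wnorm 0 = 0"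
  by (simp add: wnorm_def)

lemma wnorm_eq_0_iff [simp]: "wnorm u = 0 \<longleftrightarrow> u = 0"
  by (simp add: wnorm_def sum_nonneg_eq_0_iff vec_eq_iff)

lemma wnorm_scaleR: "wnorm (c *\<^sub>R u) = \<bar>c\<bar> * wnorm u"
  by (simp add: wnorm_def sum_distrib_left abs_mult mult_ac)

lemma wnorm_triangle: "wnorm (u + v) \<le> wnorm u + wnorm v"
  unfolding wnorm_def sum.distrib[symmetric] distrib_left[symmetric]
  by (intro sum_mono mult_left_mono) auto

lemma circuit_vector_nth:
  assumes "distinct (map fst p)"
  shows "circuit_vector p $ e = (if (e, True) \<in> set p then 1 else if (e, False) \<in> set p then - 1 else 0)"
  using assms
proof (induction p)
  case (Cons a p)
  obtain e' b where a: "a = (e', b)" by (cases a)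
  have "(e', b') \<notin> set p" for b' using Cons.prems by (force simp: a)
  with Cons show ?case by (cases b; cases "e = e'") (auto simp: a axis_def)
qed simp

lemma walk_length_eq_wnorm:
  assumes "distinct (map fst p)"
  shows "walk_length p = wnorm (circuit_vector p)"
proof -
  have "walk_length p = (\<Sum>e\<in>fst ` set p. w e)"
    using sum.distinct_set_conv_list[OF assms, of w] by (simp add: walk_length_def o_def)
  also have "\<dots> = (\<Sum>e\<in>fst ` set p. w e * \<bar>circuit_vector p $ e\<bar>)"
  proof (rule sum.cong)
    fix e assume "e \<in> fst ` set p"
    then obtain b where "(e, b) \<in> set p" by auto
    then show "w e = w e * \<bar>circuit_vector p $ e\<bar>"
      by (cases b) (simp_all add: circuit_vector_nth[OF assms])
  qed simp
  also have "\<dots> = wnorm (circuit_vector p)"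
    unfolding wnorm_def
    by (rule sum.mono_neutral_left) (force simp: circuit_vector_nth[OF assms])+
  finally show ?thesis .
qed

lemma walk_nthI:
  assumes "p \<noteq> []"
    and "\<And>i. i < length p \<Longrightarrow> head (p ! i) = (if Suc i < length p then tail (p ! Suc i) else y)"
  shows "walk (tail (hd p)) p y"
  using assms
proof (induction p)
  case (Cons a p)
  show ?case
  proof (cases p)
    case Nil
    then show ?thesis using Cons.prems(2)[of 0] by simp
  next
    case (Cons b q)
    then have "head a = tail (hd p)" using Cons.prems(2)[of 0] by simp
    moreover have "walk (tail (hd p)) p y"
      using Cons.prems(2)[of "Suc i" for i] Cons by (intro Cons.IH) (auto split: if_splits)
    ultimately show ?thesis by simp
  qed
qed simp

lemma simple_circuit_walk:
  assumes "simple_circuit p"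
  shows "walk (tail (hd p)) p (tail (hd p))"
proof (rule walk_nthI)
  show "p \<noteq> []" using assms by (simp add: simple_circuit_def)
  then show "head (p ! i) = (if Suc i < length p then tail (p ! Suc i) else tail (hd p))"
    if "i < length p" for i
    using assms that by (cases "Suc i = length p") (auto simp: simple_circuit_def hd_conv_nth)
qed

lemma circuit_in_H1: "C \<in> circuits \<Longrightarrow> C \<in> H1"
  using boundary_walk[OF simple_circuit_walk] by (auto simp: circuits_def H1_def)

lemma circuit_nonzero: "C \<in> circuits \<Longrightarrow> C \<noteq> 0"
proof
  assume "C \<in> circuits" "C = 0"
  then obtain p where p: "simple_circuit p" "circuit_vector p = 0" by (auto simp: circuits_def)
  then obtain e b where "(e, b) \<in> set p" by (cases p) (auto simp: simple_circuit_def)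
  moreover have "circuit_vector p $ e = 0" using p by simp
  moreover have "distinct (map fst p)" using p by (simp add: simple_circuit_def)
  ultimately show False by (cases b) (auto simp: circuit_vector_nth split: if_splits)
qed

lemma circuit_Ints: "C \<in> circuits \<Longrightarrow> C $ e \<in> \<int>"
  by (auto simp: circuits_def simple_circuit_def circuit_vector_nth)

lemma finite_circuits: "finite circuits"
proof -
  have "finite {p :: ('e \<times> bool) list. set p \<subseteq> UNIV \<and> distinct p}"
    by (rule finite_subset_distinct) simp
  then have "finite {p. simple_circuit p}"
    by (rule rev_finite_subset) (auto simp: simple_circuit_def distinct_map)
  then show ?thesis by (simp add: circuits_def)
qed

text \<open>
  The oriented edge \<open>a\<close> has positive coefficient in \<open>u\<close>.
\<close>

definition aligned :: "real ^ 'e \<Rightarrow> 'e \<times> bool \<Rightarrow> bool" where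
  "aligned u a \<longleftrightarrow> 0 < (if snd a then u $ fst a else - (u $ fst a))"

lemma boundary_nth:
  "boundary u $ x = (\<Sum>e\<in>UNIV. u $ e * (of_bool (tgt e = x) - of_bool (src e = x)))"
  unfolding boundary_def sum_component by (rule sum.cong) (auto simp: axis_def)

text \<open>
  Conservation of flow: at the vertex \<open>head a\<close> the flow \<open>u\<close> arriving along \<open>a\<close> must leave again. If no aligned edge
  left that vertex, all the terms \<open>T e\<close> of the net inflow there would be nonnegative, that of \<open>a\<close> being positive.
\<close>

lemma aligned_continues:
  assumes "u \<in> H1" "aligned u a"
  shows "\<exists>a'. aligned u a' \<and> tail a' = head a"
proof (rule ccontr)
  assume none: "\<not> ?thesis"
  then have none': "tail a' = head a \<Longrightarrow> \<not> aligned u a'" for a' by blast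
  define T where "T e = u $ e * (of_bool (tgt e = head a) - of_bool (src e = head a))" for e
  have "0 \<le> T e" for e
    using none'[of "(e, True)"] none'[of "(e, False)"]
    by (auto simp: T_def aligned_def tail_def)
  moreover have "sum T UNIV = 0"
    using assms(1) boundary_nth[of u "head a"] by (simp add: H1_def T_def)
  ultimately have "T (fst a) = 0" by (simp add: sum_nonneg_eq_0_iff)
  moreover have "tail a \<noteq> head a" using none assms(2) by blast
  ultimately show False
    using assms(2) by (auto simp: T_def aligned_def tail_def head_def split: if_splits)
qed

text \<open>
  Following aligned edges one returns to some vertex, and between two visits at minimal time distance
  no vertex is repeated. No edge is repeated either, since an edge is aligned in at most one of its orientations.
\<close>

lemma aligned_circuit_exists:
  assumes "u \<in> H1" "u \<noteq> 0"
  shows "\<exists>p. simple_circuit p \<and> (\<forall>a\<in>set p. aligned u a)"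
proof -
  obtain e where "u $ e \<noteq> 0" using assms(2) by (auto simp: vec_eq_iff)
  then have a0: "aligned u (e, 0 < u $ e)" by (auto simp: aligned_def)
  obtain A where A: "aligned u (A n)" "tail (A (Suc n)) = head (A n)" for n
    using dependent_nat_choice[of "\<lambda>_. aligned u" "\<lambda>_ a a'. tail a' = head a"]
      a0 aligned_continues[OF assms(1)] by metis
  define R where "R k \<longleftrightarrow> 0 < k \<and> (\<exists>i. tail (A i) = tail (A (i + k)))" for k
  have "\<not> inj (\<lambda>i. tail (A i))"
    using finite_imageD[of "\<lambda>i. tail (A i)" UNIV] by (metis finite infinite_UNIV_nat)
  then obtain i j where "i \<noteq> j" "tail (A i) = tail (A j)" by (auto simp: inj_def)
  then have "\<exists>i j. i < j \<and> tail (A i) = tail (A j)" by (metis nat_neq_iff)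
  then obtain i j where "i < j" "tail (A i) = tail (A j)" by blast
  then have "R (j - i)" unfolding R_def by (intro conjI exI[of _ i]) simp_all
  define k where "k = (LEAST k. R k)"
  have "R k" unfolding k_def by (rule LeastI) fact
  then obtain i where i: "0 < k" "tail (A i) = tail (A (i + k))" by (auto simp: R_def)
  have least: "\<not> R k'" if "k' < k" for k' using that not_less_Least unfolding k_def by blast
  define p where "p = map (\<lambda>m. A (i + m)) [0..<k]"
  have nth: "p ! m = A (i + m)" if "m < k" for m using that by (simp add: p_def)
  have len: "length p = k" by (simp add: p_def)
  have tails: "tail (A (i + m)) \<noteq> tail (A (i + n))" if "m < n" "n < k" for m n
  proof
    assume "tail (A (i + m)) = tail (A (i + n))"
    then have "R (n - m)" unfolding R_def using that by (intro conjI exI[of _ "i + m"]) simp_all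
    then show False using least[of "n - m"] that by simp
  qed
  then have tails': "m = n" if "m < k" "n < k" "tail (A (i + m)) = tail (A (i + n))" for m n
    using that by (metis nat_neq_iff)
  have "a = a'" if "aligned u a" "aligned u a'" "fst a = fst a'" for a a'
    using that by (cases a; cases a') (auto simp: aligned_def split: if_splits)
  then have "m = n" if "m < k" "n < k" "fst (A (i + m)) = fst (A (i + n))" for m n
    using tails' A(1) that by metis
  then have "distinct (map fst p)"
    by (auto simp: p_def distinct_map inj_on_def)
  moreover have "distinct (map tail p)"
    using tails' by (auto simp: p_def distinct_map inj_on_def)
  moreover have "head (p ! m) = tail (p ! (Suc m mod length p))" if "m < length p" for m
  proof (cases "Suc m = k")
    case True
    then show ?thesis using i A(2)[of "i + m"] by (auto simp: len nth)
  next
    case False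
    then show ?thesis using that A(2)[of "i + m"] by (simp add: len nth)
  qed
  ultimately have "simple_circuit p" using i(1) by (auto simp: simple_circuit_def p_def)
  moreover have "\<forall>a\<in>set p. aligned u a" using A(1) by (auto simp: p_def)
  ultimately show ?thesis by blast
qed

text \<open>
  Subtract as much of an aligned circuit as the signs of \<open>u\<close> permit: the coefficient \<open>c\<close> is the least flow on its edges,
  so that one of these edges drops out of the support and no coefficient changes its sign.
\<close>

lemma peel_circuit:
  fixes u :: "real ^ 'e"
  assumes "u \<in> H1" "u \<noteq> 0"
  obtains C c where "C \<in> circuits" "0 < c" "{e. (u - c *\<^sub>R C) $ e \<noteq> 0} \<subset> {e. u $ e \<noteq> 0}"
    "wnorm u = c * wnorm C + wnorm (u - c *\<^sub>R C)" "(\<forall>e. u $ e \<in> \<int>) \<longrightarrow> c \<in> \<int>"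
proof -
  obtain p where p: "simple_circuit p" and al: "\<And>a. a \<in> set p \<Longrightarrow> aligned u a"
    using aligned_circuit_exists[OF assms] by blast
  have dist: "distinct (map fst p)" and "p \<noteq> []" using p by (auto simp: simple_circuit_def)
  define C where "C = circuit_vector p"
  define M where "M = (\<lambda>a. \<bar>u $ fst a\<bar>) ` set p"
  define c where "c = Min M"
  have M: "finite M" "M \<noteq> {}" using \<open>p \<noteq> []\<close> by (auto simp: M_def)
  then have "c \<in> M" unfolding c_def by (rule Min_in)
  then obtain a0 where a0: "a0 \<in> set p" "c = \<bar>u $ fst a0\<bar>"
    by (auto simp: M_def)
  have c_le: "c \<le> \<bar>u $ fst a\<bar>" if "a \<in> set p" for a
    using M that by (auto simp: M_def c_def)
  have "0 < c" using a0 al[of a0] by (auto simp: aligned_def split: if_splits)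
  have on: "u $ fst a = \<bar>u $ fst a\<bar> * C $ fst a \<and> \<bar>C $ fst a\<bar> = 1 \<and> u $ fst a \<noteq> 0" if "a \<in> set p" for a
  proof -
    obtain e b where a: "a = (e, b)" by (cases a)
    have "(e, \<not> b) \<notin> set p" using dist that a by (force simp: distinct_map inj_on_def)
    then show ?thesis using that al[OF that]
      by (cases b) (auto simp: a C_def circuit_vector_nth[OF dist] aligned_def)
  qed
  have off: "C $ e = 0" if "e \<notin> fst ` set p" for e
    using that by (force simp: C_def circuit_vector_nth[OF dist])
  have split: "\<bar>u $ e\<bar> = c * \<bar>C $ e\<bar> + \<bar>(u - c *\<^sub>R C) $ e\<bar>" for e
  proof (cases "e \<in> fst ` set p")
    case True
    then obtain a where a: "a \<in> set p" "e = fst a" by auto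
    have "(u - c *\<^sub>R C) $ e = (\<bar>u $ e\<bar> - c) * C $ e"
      using on[OF a(1)] a(2) by (simp add: left_diff_distrib)
    then have "\<bar>(u - c *\<^sub>R C) $ e\<bar> = \<bar>u $ e\<bar> - c"
      using on[OF a(1)] c_le[OF a(1)] a(2) by (simp add: abs_mult)
    then show ?thesis using on[OF a(1)] a(2) by simp
  qed (simp add: off)
  show ?thesis
  proof (rule that)
    show "C \<in> circuits" using p by (auto simp: circuits_def C_def)
    show "0 < c" by fact
    show "{e. (u - c *\<^sub>R C) $ e \<noteq> 0} \<subset> {e. u $ e \<noteq> 0}"
    proof (rule psubsetI)
      show "{e. (u - c *\<^sub>R C) $ e \<noteq> 0} \<subseteq> {e. u $ e \<noteq> 0}"
      proof clarify
        fix e assume "(u - c *\<^sub>R C) $ e \<noteq> 0" "u $ e = 0"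
        then show False using split[of e] \<open>0 < c\<close> by (simp add: add_nonneg_eq_0_iff)
      qed
      have "(u - c *\<^sub>R C) $ fst a0 = 0" using split[of "fst a0"] on[OF a0(1)] a0(2) by simp
      then show "{e. (u - c *\<^sub>R C) $ e \<noteq> 0} \<noteq> {e. u $ e \<noteq> 0}" using on[OF a0(1)] by blast
    qed
    show "wnorm u = c * wnorm C + wnorm (u - c *\<^sub>R C)"
      unfolding wnorm_def sum_distrib_left sum.distrib[symmetric]
      by (rule sum.cong) (simp_all add: split[unfolded vector_minus_component] algebra_simps)
    show "(\<forall>e. u $ e \<in> \<int>) \<longrightarrow> c \<in> \<int>" using a0(2) by simp
  qed
qed

lemma circuit_decomposition:
  fixes u :: "real ^ 'e"
  assumes "u \<in> H1"
  obtains f where "\<And>C. 0 \<le> f C" "u = (\<Sum>C\<in>circuits. f C *\<^sub>R C)"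
    "wnorm u = (\<Sum>C\<in>circuits. f C * wnorm C)"
    "(\<forall>e. u $ e \<in> \<int>) \<longrightarrow> (\<forall>C. f C \<in> \<int>)"
proof -
  have "\<exists>f. (\<forall>C. 0 \<le> f C) \<and> u = (\<Sum>C\<in>circuits. f C *\<^sub>R C)
      \<and> wnorm u = (\<Sum>C\<in>circuits. f C * wnorm C) \<and> ((\<forall>e. u $ e \<in> \<int>) \<longrightarrow> (\<forall>C. f C \<in> \<int>))"
    using assms
  proof (induction "card {e. u $ e \<noteq> 0}" arbitrary: u rule: less_induct)
    case less
    show ?case
    proof (cases "u = 0")
      case True
      then show ?thesis by (intro exI[of _ "\<lambda>_. 0"]) simp
    next
      case False
      with less.prems obtain C c where C: "C \<in> circuits" "0 < c"
        "{e. (u - c *\<^sub>R C) $ e \<noteq> 0} \<subset> {e. u $ e \<noteq> 0}"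
        "wnorm u = c * wnorm C + wnorm (u - c *\<^sub>R C)" "(\<forall>e. u $ e \<in> \<int>) \<longrightarrow> c \<in> \<int>"
        by (rule peel_circuit)
      have "card {e. (u - c *\<^sub>R C) $ e \<noteq> 0} < card {e. u $ e \<noteq> 0}"
        using C(3) by (intro psubset_card_mono) auto
      moreover have "u - c *\<^sub>R C \<in> H1"
        using H1_add[OF less.prems H1_scaleR[OF circuit_in_H1[OF C(1)], of "- c"]] by simp
      ultimately obtain f where f: "\<And>C. 0 \<le> f C" "u - c *\<^sub>R C = (\<Sum>C\<in>circuits. f C *\<^sub>R C)"
        "wnorm (u - c *\<^sub>R C) = (\<Sum>C\<in>circuits. f C * wnorm C)"
        "(\<forall>e. (u - c *\<^sub>R C) $ e \<in> \<int>) \<longrightarrow> (\<forall>C. f C \<in> \<int>)"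
        using less.hyps by blast
      let ?g = "\<lambda>D. f D + (if D = C then c else 0)"
      have "(\<Sum>D\<in>circuits. ?g D *\<^sub>R D) = (\<Sum>D\<in>circuits. f D *\<^sub>R D + (if D = C then c *\<^sub>R C else 0))"
        by (rule sum.cong) (auto simp: scaleR_add_left)
      also have "\<dots> = u"
        using C(1) finite_circuits f(2) by (simp add: sum.distrib flip: f(2))
      finally have "(\<Sum>D\<in>circuits. ?g D *\<^sub>R D) = u" .
      moreover have "(\<Sum>D\<in>circuits. ?g D * wnorm D)
          = (\<Sum>D\<in>circuits. f D * wnorm D + (if D = C then c * wnorm C else 0))"
        by (rule sum.cong) (auto simp: distrib_right)
      then have "(\<Sum>D\<in>circuits. ?g D * wnorm D) = wnorm u"
        using C(1,4) finite_circuits f(3) by (simp add: sum.distrib)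
      moreover have "\<forall>D. ?g D \<in> \<int>" if "\<forall>e. u $ e \<in> \<int>"
        using that C(5) f(4) circuit_Ints[OF C(1)] by (auto intro!: Ints_add Ints_diff Ints_mult)
      moreover have "\<forall>D. 0 \<le> ?g D" using f(1) C(2) by (simp add: add_nonneg_nonneg)
      ultimately show ?thesis by (intro exI[of _ ?g]) simp
    qed
  qed
  then show ?thesis using that by blast
qed

section \<open>The stable norm is the weighted \<open>\<ell>\<^sup>1\<close> norm\<close>

text \<open>
  The constant \<open>K\<close> is the cost of going from the base point \<open>x\<close> to the circuits and back by the same paths, whose
  contributions to the chain cancel.
\<close>

lemma walk_along_multiples:
  fixes k :: "real ^ 'e \<Rightarrow> nat"
  assumes "S \<subseteq> circuits"
  shows "\<exists>K. \<forall>n. \<exists>p. walk x p x \<and> circuit_vector p = real n *\<^sub>R (\<Sum>C\<in>S. real (k C) *\<^sub>R C)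
            \<and> walk_length p \<le> real n * (\<Sum>C\<in>S. real (k C) * wnorm C) + K"
proof -
  have "finite S" using assms finite_circuits finite_subset by blast
  then show ?thesis using assms
  proof (induction S)
    case empty
    have "walk x [] x \<and> circuit_vector [] = 0 \<and> walk_length [] \<le> (0::real)" by simp
    then show ?case by (intro exI[of _ 0] allI exI[of _ "[]"]) simp
  next
    case (insert C S)
    then obtain K where K: "\<forall>n. \<exists>p. walk x p x \<and> circuit_vector p = real n *\<^sub>R (\<Sum>C\<in>S. real (k C) *\<^sub>R C)
            \<and> walk_length p \<le> real n * (\<Sum>C\<in>S. real (k C) * wnorm C) + K" by auto
    from insert.prems obtain c where c: "simple_circuit c" "C = circuit_vector c"
      by (auto simp: circuits_def)
    then have len: "walk_length c = wnorm C"
      by (simp add: walk_length_eq_wnorm simple_circuit_def)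
    obtain q where q: "walk x q (tail (hd c))" using walk_exists by blast
    have "\<exists>p. walk x p x \<and> circuit_vector p = real n *\<^sub>R (\<Sum>C\<in>insert C S. real (k C) *\<^sub>R C)
            \<and> walk_length p \<le> real n * (\<Sum>C\<in>insert C S. real (k C) * wnorm C) + (K + 2 * walk_length q)" for n
    proof -
      obtain p where p: "walk x p x" "circuit_vector p = real n *\<^sub>R (\<Sum>C\<in>S. real (k C) *\<^sub>R C)"
        "walk_length p \<le> real n * (\<Sum>C\<in>S. real (k C) * wnorm C) + K" using K by blast
      define r where "r = concat (replicate (n * k C) c)"
      note r = walk_repeat[OF simple_circuit_walk[OF c(1)], of "n * k C", folded r_def]
      let ?p = "p @ q @ r @ rev_walk q"
      have "walk x ?p x"
        unfolding walk_append using p(1) q r(1) walk_rev[OF q] by blast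
      moreover have "circuit_vector ?p = real n *\<^sub>R (\<Sum>C\<in>insert C S. real (k C) *\<^sub>R C)"
        using insert.hyps by (simp add: circuit_vector_rev p(2) r(2) c(2)[symmetric] scaleR_add_right)
      moreover have "walk_length ?p \<le> real n * (\<Sum>C\<in>insert C S. real (k C) * wnorm C) + (K + 2 * walk_length q)"
        using insert.hyps p(3) by (simp add: walk_length_rev r(3) len distrib_left mult.assoc)
      ultimately show ?thesis by blast
    qed
    then show ?case by blast
  qed
qed

lemma H1_int_decomposition:
  assumes "v \<in> H1_int"
  obtains k :: "real ^ 'e \<Rightarrow> nat" where "v = (\<Sum>C\<in>circuits. real (k C) *\<^sub>R C)"
    "wnorm v = (\<Sum>C\<in>circuits. real (k C) * wnorm C)"
proof -
  from assms have "v \<in> H1" and "\<forall>e. v $ e \<in> \<int>" by (auto simp: H1_int_def)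
  from \<open>v \<in> H1\<close> obtain f where f: "\<And>C. 0 \<le> f C" "v = (\<Sum>C\<in>circuits. f C *\<^sub>R C)"
    "wnorm v = (\<Sum>C\<in>circuits. f C * wnorm C)" "(\<forall>e. v $ e \<in> \<int>) \<longrightarrow> (\<forall>C. f C \<in> \<int>)"
    by (rule circuit_decomposition) blast
  with \<open>\<forall>e. v $ e \<in> \<int>\<close> have int: "f C \<in> \<int>" for C by blast
  have "f C = real (nat \<lfloor>f C\<rfloor>)" for C
    using f(1)[of C] int[of C] by (elim Ints_cases) simp
  with f(2,3) show ?thesis by (intro that[of "\<lambda>C. nat \<lfloor>f C\<rfloor>"]) simp_all
qed

lemma stable_norm_int_eq_wnorm:
  assumes "v \<in> H1_int"
  shows "stable_norm_int v = wnorm v"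
proof -
  obtain k :: "real ^ 'e \<Rightarrow> nat" where k: "v = (\<Sum>C\<in>circuits. real (k C) *\<^sub>R C)"
    "wnorm v = (\<Sum>C\<in>circuits. real (k C) * wnorm C)"
    using H1_int_decomposition[OF assms] .
  obtain x :: 'v where True by simp
  obtain K where K: "\<And>n. \<exists>p. walk x p x \<and> circuit_vector p = real n *\<^sub>R v
            \<and> walk_length p \<le> real n * wnorm v + K"
    using walk_along_multiples[of circuits x k] unfolding k(1)[symmetric] k(2)[symmetric] by auto
  have bounds: "real n * wnorm v \<le> shortest_length (real n *\<^sub>R v)"
    "shortest_length (real n *\<^sub>R v) \<le> real n * wnorm v + K" for n
  proof -
    obtain p where p: "walk x p x" "circuit_vector p = real n *\<^sub>R v"
      "walk_length p \<le> real n * wnorm v + K" using K by blast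
    show "real n * wnorm v \<le> shortest_length (real n *\<^sub>R v)"
      "shortest_length (real n *\<^sub>R v) \<le> real n * wnorm v + K"
      using shortest_length_bounds[OF p(1)] p(2,3) by (simp_all add: wnorm_scaleR)
  qed
  have "(\<lambda>n. shortest_length (real n *\<^sub>R v) / real n) \<longlonglongrightarrow> wnorm v"
  proof (rule real_tendsto_sandwich)
    show "\<forall>\<^sub>F n in sequentially. wnorm v \<le> shortest_length (real n *\<^sub>R v) / real n"
      using eventually_gt_at_top[of 0] by eventually_elim (use bounds(1) in \<open>simp add: field_simps\<close>)
    show "\<forall>\<^sub>F n in sequentially. shortest_length (real n *\<^sub>R v) / real n \<le> wnorm v + K / real n"
      using eventually_gt_at_top[of 0] by eventually_elim (use bounds(2) in \<open>simp add: field_simps\<close>)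
    show "(\<lambda>n. wnorm v + K / real n) \<longlonglongrightarrow> wnorm v"
      using tendsto_add[OF tendsto_const lim_const_over_n[of K]] by simp
  qed simp
  then show ?thesis unfolding stable_norm_int_def by (rule limI)
qed

text \<open>
  Round down the coefficients of a circuit decomposition of \<open>(n + 1) u\<close>: the circuits being integral, the result is an
  integral cycle.
\<close>

lemma H1_rational_dense:
  assumes "u \<in> H1"
  obtains V where "\<And>n. V n \<in> H1_int" "(\<lambda>n. V n /\<^sub>R real (Suc n)) \<longlonglongrightarrow> u"
proof -
  obtain f where f: "u = (\<Sum>C\<in>circuits. f C *\<^sub>R C)"
    by (rule circuit_decomposition[OF assms]) blast
  define V where "V n = (\<Sum>C\<in>circuits. of_int \<lfloor>real (Suc n) * f C\<rfloor> *\<^sub>R C)" for n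
  have lim: "(\<lambda>n. of_int \<lfloor>real (Suc n) * a\<rfloor> / real (Suc n)) \<longlonglongrightarrow> a" for a :: real
  proof (rule real_tendsto_sandwich)
    show "\<forall>\<^sub>F n in sequentially. a - inverse (real (Suc n)) \<le> of_int \<lfloor>real (Suc n) * a\<rfloor> / real (Suc n)"
    proof (rule always_eventually, rule allI)
      fix n
      have "(a - inverse (real (Suc n))) * real (Suc n) = real (Suc n) * a - 1"
        by (simp add: algebra_simps del: of_nat_Suc)
      also have "\<dots> \<le> of_int \<lfloor>real (Suc n) * a\<rfloor>" by linarith
      finally show "a - inverse (real (Suc n)) \<le> of_int \<lfloor>real (Suc n) * a\<rfloor> / real (Suc n)"
        by (subst pos_le_divide_eq) simp_all
    qed
    show "\<forall>\<^sub>F n in sequentially. of_int \<lfloor>real (Suc n) * a\<rfloor> / real (Suc n) \<le> a"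
    proof (rule always_eventually, rule allI)
      fix n
      have "of_int \<lfloor>real (Suc n) * a\<rfloor> \<le> real (Suc n) * a" by linarith
      also have "\<dots> = a * real (Suc n)" by (rule mult.commute)
      finally show "of_int \<lfloor>real (Suc n) * a\<rfloor> / real (Suc n) \<le> a"
        by (subst pos_divide_le_eq) simp_all
    qed
    show "(\<lambda>n. a - inverse (real (Suc n))) \<longlonglongrightarrow> a"
      using tendsto_diff[OF tendsto_const LIMSEQ_inverse_real_of_nat] by simp
  qed simp
  show ?thesis
  proof (rule that)
    have "V n \<in> H1" for n
      unfolding V_def by (intro H1_sum H1_scaleR circuit_in_H1)
    then show "V n \<in> H1_int" for n
      by (auto simp: H1_int_def V_def intro!: Ints_sum Ints_mult circuit_Ints)
    have "(\<lambda>n. \<Sum>C\<in>circuits. (of_int \<lfloor>real (Suc n) * f C\<rfloor> / real (Suc n)) *\<^sub>R C) \<longlonglongrightarrow> u"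
      unfolding f by (intro tendsto_sum tendsto_scaleR lim tendsto_const)
    then show "(\<lambda>n. V n /\<^sub>R real (Suc n)) \<longlonglongrightarrow> u"
      by (simp add: V_def scaleR_sum_right divide_inverse mult.commute del: of_nat_Suc)
  qed
qed

lemma continuous_on_wnorm: "continuous_on S wnorm"
  unfolding wnorm_def[abs_def] by (intro continuous_intros)

lemma wnorm_divide: "wnorm (u /\<^sub>R real n) = wnorm u / real n"
  by (simp add: wnorm_scaleR divide_inverse mult.commute)

text \<open>
  Besides the uniqueness of the extension, its existence has to be checked: a definite description says nothing otherwise.
\<close>

lemma stable_norm_eq_wnorm:
  assumes "u \<in> H1"
  shows "stable_norm u = wnorm u"
proof -
  have "stable_norm = (\<lambda>u. if u \<in> H1 then wnorm u else 0)"
    unfolding stable_norm_def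
  proof (rule the_equality, intro conjI ballI allI impI)
    show "continuous_on H1 (\<lambda>u. if u \<in> H1 then wnorm u else 0)"
      using continuous_on_wnorm by (rule continuous_on_eq) simp
  next
    fix v and k :: nat assume "v \<in> H1_int" "0 < k"
    then show "(if v /\<^sub>R real k \<in> H1 then wnorm (v /\<^sub>R real k) else 0) = stable_norm_int v / real k"
      using H1_scaleR[of v "inverse (real k)"]
      by (auto simp: stable_norm_int_eq_wnorm H1_int_def wnorm_divide)
  next
    fix u assume "u \<notin> H1"
    then show "(if u \<in> H1 then wnorm u else 0) = 0" by simp
  next
    fix N
    assume N: "continuous_on H1 N \<and> (\<forall>v\<in>H1_int. \<forall>k. 0 < k \<longrightarrow> N (v /\<^sub>R real k) = stable_norm_int v / real k)
      \<and> (\<forall>u. u \<notin> H1 \<longrightarrow> N u = 0)"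
    have "N u = wnorm u" if u: "u \<in> H1" for u
    proof -
      obtain V where V: "\<And>n. V n \<in> H1_int" "(\<lambda>n. V n /\<^sub>R real (Suc n)) \<longlonglongrightarrow> u"
        using H1_rational_dense[OF u] by blast
      have in_H1: "V n /\<^sub>R real (Suc n) \<in> H1" for n
        using V(1)[of n] H1_scaleR[of "V n"] by (simp add: H1_int_def)
      have eq: "N (V n /\<^sub>R real (Suc n)) = wnorm (V n /\<^sub>R real (Suc n))" for n
        using N V(1)[of n] by (simp add: stable_norm_int_eq_wnorm wnorm_divide del: of_nat_Suc)
      have lim: "(\<lambda>n. g (V n /\<^sub>R real (Suc n))) \<longlonglongrightarrow> g u" if "continuous_on H1 g" for g :: "_ \<Rightarrow> real"
        using continuous_on_tendsto_compose[OF that V(2) u] in_H1 by simp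
      from lim[OF conjunct1[OF N]] have "(\<lambda>n. wnorm (V n /\<^sub>R real (Suc n))) \<longlonglongrightarrow> N u"
        unfolding eq .
      then show ?thesis by (rule LIMSEQ_unique) (rule lim[OF continuous_on_wnorm])
    qed
    then show "N = (\<lambda>u. if u \<in> H1 then wnorm u else 0)"
      using N by auto
  qed
  then show ?thesis using assms by simp
qed

section \<open>The unit ball\<close>

lemma normalized_in_circuit_hull:
  assumes "u \<in> H1" "u \<noteq> 0"
  shows "u /\<^sub>R wnorm u \<in> convex hull {C /\<^sub>R wnorm C | C. C \<in> circuits}"
proof -
  obtain f where f: "\<And>C. 0 \<le> f C" "u = (\<Sum>C\<in>circuits. f C *\<^sub>R C)"
    "wnorm u = (\<Sum>C\<in>circuits. f C * wnorm C)"
    by (rule circuit_decomposition[OF assms(1)]) blast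
  have "(\<Sum>C\<in>circuits. (f C * wnorm C / wnorm u) *\<^sub>R (C /\<^sub>R wnorm C))
      \<in> convex hull {C /\<^sub>R wnorm C | C. C \<in> circuits}"
  proof (rule convex_sum)
    show "(\<Sum>C\<in>circuits. f C * wnorm C / wnorm u) = 1"
      using assms(2) by (simp add: f(3) flip: sum_divide_distrib) (simp flip: f(3))
  qed (use finite_circuits f(1) in \<open>auto intro!: hull_inc\<close>)
  also have "(\<Sum>C\<in>circuits. (f C * wnorm C / wnorm u) *\<^sub>R (C /\<^sub>R wnorm C)) = (\<Sum>C\<in>circuits. (f C / wnorm u) *\<^sub>R C)"
    by (rule sum.cong) (use circuit_nonzero in auto)
  also have "\<dots> = u /\<^sub>R wnorm u"
    by (subst (3) f(2)) (simp add: scaleR_sum_right divide_inverse mult.commute)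
  finally show ?thesis .
qed

lemma wnorm_ball_eq_circuit_hull:
  assumes "H1 \<noteq> {0}"
  shows "{u \<in> H1. wnorm u \<le> 1} = convex hull {C /\<^sub>R wnorm C | C. C \<in> circuits}" (is "?B = ?H")
proof
  have "convex ?B"
  proof (rule convexI)
    fix u v and a b :: real assume uv: "u \<in> ?B" "v \<in> ?B" and ab: "0 \<le> a" "0 \<le> b" "a + b = 1"
    have "wnorm (a *\<^sub>R u + b *\<^sub>R v) \<le> a * wnorm u + b * wnorm v"
      using wnorm_triangle[of "a *\<^sub>R u" "b *\<^sub>R v"] ab by (simp add: wnorm_scaleR)
    also have "\<dots> \<le> 1" using uv ab by (intro convex_bound_le) auto
    finally show "a *\<^sub>R u + b *\<^sub>R v \<in> ?B" using uv by (simp add: H1_add H1_scaleR)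
  qed
  then show "?H \<subseteq> ?B"
    by (intro hull_minimal) (auto simp: H1_scaleR circuit_in_H1 wnorm_scaleR circuit_nonzero)
next
  obtain z where z: "z \<in> H1" "z \<noteq> 0" using assms H1_zero by blast
  have "- z \<in> H1" using H1_scaleR[OF z(1), of "-1"] by simp
  moreover have "wnorm (- z) = wnorm z" using wnorm_scaleR[of "-1" z] by simp
  ultimately have "z /\<^sub>R wnorm z \<in> ?H" "- (z /\<^sub>R wnorm z) \<in> ?H"
    using normalized_in_circuit_hull[of z] normalized_in_circuit_hull[of "- z"] z by auto
  from convexD[OF convex_convex_hull this, of "1/2" "1/2"] have 0: "0 \<in> ?H" by simp
  show "?B \<subseteq> ?H"
  proof
    fix u assume u: "u \<in> ?B"
    show "u \<in> ?H"
    proof (cases "u = 0")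
      case False
      with u have "u /\<^sub>R wnorm u \<in> ?H" by (intro normalized_in_circuit_hull) auto
      from convexD[OF convex_convex_hull 0 this, of "1 - wnorm u" "wnorm u"] u False show ?thesis by simp
    qed (use 0 in simp)
  qed
qed

end

theorem mainTheorem1:
  fixes src tgt :: "'e::finite \<Rightarrow> 'v::finite" and w :: "'e \<Rightarrow> real"
  assumes "weighted_graph src tgt w"
    and "weighted_graph.H1 src tgt \<noteq> {0}"
  shows "{u \<in> weighted_graph.H1 src tgt. weighted_graph.stable_norm src tgt w u \<le> 1}
       = convex hull {C /\<^sub>R weighted_graph.stable_norm src tgt w C | C.
                        C \<in> weighted_graph.circuits src tgt}"
proof -
  interpret weighted_graph src tgt w by fact
  have "{u \<in> H1. stable_norm u \<le> 1} = {u \<in> H1. wnorm u \<le> 1}"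
    using stable_norm_eq_wnorm by auto
  moreover have "{C /\<^sub>R stable_norm C | C. C \<in> circuits} = {C /\<^sub>R wnorm C | C. C \<in> circuits}"
    using stable_norm_eq_wnorm circuit_in_H1 by metis
  ultimately show ?thesis using wnorm_ball_eq_circuit_hull assms(2) by simp
qed

end
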